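(* Let $k$ be a commutative ring and let $A$ be a commutative $k$-algebra that is a finitely generated projective $k$-module of rank $r$. Let $I$ be the kernel of the multiplication map $\mu\colon A\otimes_kA\to A$, and let $J$ be the annihilator of $I$ in $A\otimes_kA$. Assume that $I$ and $J$ are both principal ideals. Then the $A$-modules $A^\vee=\operatorname{Hom}_k(A,k)$ and $J$ are both free of rank one, and the map $\theta_0\colon A^\vee\to J^*=\operatorname{Hom}_A(J,A)$ given by $\theta_0(\phi)=(1\otimes\phi)|_J$ is an $A$-linear isomorphism.
   Context: $A\otimes_kA$ (and hence $I$ and $J$) is regarded as an $A$-module via $a\mapsto a\otimes 1$. $A^\vee$ is an $A$-module by $(a\phi)(m)=\phi(am)$. For $\phi\in A^\vee$, $1\otimes\phi\colon A\otimes_kA\to A$ is the $A$-linear map $a\otimes b\mapsto\phi(b)a$. *)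

theory Defs
  imports "HOL-Algebra.Module" "HOL-Algebra.QuotRing" "HOL-Library.Poly_Mapping"
begin

section \<open>Modules over a commutative ring\<close>

text \<open>
  Modules are records of type \<open>module\<close> from HOL-Algebra. That record extends \<open>ring\<close>, but the locale
  \<open>module\<close> ignores the fields \<open>mult\<close> and \<open>one\<close>; they are left \<open>undefined\<close> below where the module
  carries no multiplication.
\<close>

definition regular_module :: "('r, 'x) ring_scheme \<Rightarrow> ('r, 'r) module" where
  "regular_module R =
     \<lparr>carrier = carrier R, mult = mult R, one = one R, zero = zero R, add = add R, smult = monoid.mult R\<rparr>"

definition free_module :: "('r, 'x) ring_scheme \<Rightarrow> nat \<Rightarrow> ('r, nat \<Rightarrow> 'r) module" where
  "free_module R n =
     \<lparr>carrier = {..<n} \<rightarrow>\<^sub>E carrier R,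
      mult = undefined, one = undefined,
      zero = (\<lambda>i\<in>{..<n}. \<zero>\<^bsub>R\<^esub>),
      add = (\<lambda>v w. \<lambda>i\<in>{..<n}. v i \<oplus>\<^bsub>R\<^esub> w i),
      smult = (\<lambda>a v. \<lambda>i\<in>{..<n}. a \<otimes>\<^bsub>R\<^esub> v i)\<rparr>"

text \<open>Maps are extensional, so that two of them are equal iff they agree on the carrier.\<close>

definition linear_maps ::
    "('r, 'x) ring_scheme \<Rightarrow> ('r, 'm, 'y) module_scheme \<Rightarrow> ('r, 'n, 'z) module_scheme \<Rightarrow> ('m \<Rightarrow> 'n) set" where
  "linear_maps R M N =
     {f \<in> carrier M \<rightarrow>\<^sub>E carrier N.
        (\<forall>x\<in>carrier M. \<forall>y\<in>carrier M. f (x \<oplus>\<^bsub>M\<^esub> y) = f x \<oplus>\<^bsub>N\<^esub> f y) \<and>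
        (\<forall>a\<in>carrier R. \<forall>x\<in>carrier M. f (a \<odot>\<^bsub>M\<^esub> x) = a \<odot>\<^bsub>N\<^esub> f x)}"

definition module_iso ::
    "('r, 'x) ring_scheme \<Rightarrow> ('r, 'm, 'y) module_scheme \<Rightarrow> ('r, 'n, 'z) module_scheme \<Rightarrow> ('m \<Rightarrow> 'n) set" where
  "module_iso R M N = {f \<in> linear_maps R M N. bij_betw f (carrier M) (carrier N)}"

definition Hom_module ::
    "('r, 'x) ring_scheme \<Rightarrow> ('r, 'm, 'y) module_scheme \<Rightarrow> ('r, 'n, 'z) module_scheme
      \<Rightarrow> ('r, 'm \<Rightarrow> 'n) module" where
  "Hom_module R M N =
     \<lparr>carrier = linear_maps R M N,
      mult = undefined, one = undefined,
      zero = (\<lambda>x\<in>carrier M. \<zero>\<^bsub>N\<^esub>),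
      add = (\<lambda>f g. \<lambda>x\<in>carrier M. f x \<oplus>\<^bsub>N\<^esub> g x),
      smult = (\<lambda>a f. \<lambda>x\<in>carrier M. a \<odot>\<^bsub>N\<^esub> f x)\<rparr>"

definition free_of_rank :: "('r, 'x) ring_scheme \<Rightarrow> ('r, 'm, 'y) module_scheme \<Rightarrow> nat \<Rightarrow> bool" where
  "free_of_rank R M n \<longleftrightarrow> module R M \<and> module_iso R (free_module R n) M \<noteq> {}"

text \<open>Finitely generated and projective, as a direct summand (retract) of some \<open>R\<^sup>n\<close>.\<close>

definition fg_projective :: "('r, 'x) ring_scheme \<Rightarrow> ('r, 'm, 'y) module_scheme \<Rightarrow> bool" where
  "fg_projective R M \<longleftrightarrow>
     module R M \<and>
     (\<exists>n. \<exists>s\<in>linear_maps R M (free_module R n). \<exists>p\<in>linear_maps R (free_module R n) M.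
        \<forall>x\<in>carrier M. p (s x) = x)"


section \<open>Localization and rank\<close>

text \<open>
  Fractions \<open>m/s\<close> with \<open>m\<close> in \<open>M\<close> and \<open>s\<close> in a multiplicative subset \<open>S\<close> of \<open>R\<close>, where
  \<open>m/s = n/t\<close> iff \<open>u t m = u s n\<close> for some \<open>u\<close> in \<open>S\<close>. The localization of the ring \<open>R\<close> uses the same
  relation on the regular module.
\<close>

definition loc_rel ::
    "('r, 'x) ring_scheme \<Rightarrow> ('r, 'm, 'y) module_scheme \<Rightarrow> 'r set \<Rightarrow> (('m \<times> 'r) \<times> ('m \<times> 'r)) set" where
  "loc_rel R M S =
     {((m, s), (n, t)). m \<in> carrier M \<and> s \<in> S \<and> n \<in> carrier M \<and> t \<in> S \<and>
        (\<exists>u\<in>S. u \<odot>\<^bsub>M\<^esub> (t \<odot>\<^bsub>M\<^esub> m) = u \<odot>\<^bsub>M\<^esub> (s \<odot>\<^bsub>M\<^esub> n))}"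

definition loc_frac ::
    "('r, 'x) ring_scheme \<Rightarrow> ('r, 'm, 'y) module_scheme \<Rightarrow> 'r set \<Rightarrow> 'm \<Rightarrow> 'r \<Rightarrow> ('m \<times> 'r) set" where
  "loc_frac R M S m s = loc_rel R M S `` {(m, s)}"

definition loc_ring :: "('r, 'x) ring_scheme \<Rightarrow> 'r set \<Rightarrow> ('r \<times> 'r) set ring" where
  "loc_ring R S =
     \<lparr>carrier = (carrier R \<times> S) // loc_rel R (regular_module R) S,
      mult = (\<lambda>X Y. \<Union>(a, s)\<in>X. \<Union>(b, t)\<in>Y.
                loc_frac R (regular_module R) S (a \<otimes>\<^bsub>R\<^esub> b) (s \<otimes>\<^bsub>R\<^esub> t)),
      one = loc_frac R (regular_module R) S \<one>\<^bsub>R\<^esub> \<one>\<^bsub>R\<^esub>,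
      zero = loc_frac R (regular_module R) S \<zero>\<^bsub>R\<^esub> \<one>\<^bsub>R\<^esub>,
      add = (\<lambda>X Y. \<Union>(a, s)\<in>X. \<Union>(b, t)\<in>Y.
               loc_frac R (regular_module R) S (t \<otimes>\<^bsub>R\<^esub> a \<oplus>\<^bsub>R\<^esub> s \<otimes>\<^bsub>R\<^esub> b) (s \<otimes>\<^bsub>R\<^esub> t))\<rparr>"

definition loc_module ::
    "('r, 'x) ring_scheme \<Rightarrow> ('r, 'm, 'y) module_scheme \<Rightarrow> 'r set
      \<Rightarrow> (('r \<times> 'r) set, ('m \<times> 'r) set) module" where
  "loc_module R M S =
     \<lparr>carrier = (carrier M \<times> S) // loc_rel R M S,
      mult = undefined, one = undefined,
      zero = loc_frac R M S \<zero>\<^bsub>M\<^esub> \<one>\<^bsub>R\<^esub>,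
      add = (\<lambda>X Y. \<Union>(m, s)\<in>X. \<Union>(n, t)\<in>Y.
               loc_frac R M S (t \<odot>\<^bsub>M\<^esub> m \<oplus>\<^bsub>M\<^esub> s \<odot>\<^bsub>M\<^esub> n) (s \<otimes>\<^bsub>R\<^esub> t)),
      smult = (\<lambda>X Y. \<Union>(a, s)\<in>X. \<Union>(m, t)\<in>Y.
                 loc_frac R M S (a \<odot>\<^bsub>M\<^esub> m) (s \<otimes>\<^bsub>R\<^esub> t))\<rparr>"

text \<open>Rank \<open>r\<close> means constant rank: the localization at every prime is free of rank \<open>r\<close>.\<close>

definition has_rank :: "('r, 'x) ring_scheme \<Rightarrow> ('r, 'm, 'y) module_scheme \<Rightarrow> nat \<Rightarrow> bool" where
  "has_rank R M r \<longleftrightarrow>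
     (\<forall>P. primeideal P R \<longrightarrow>
        free_of_rank (loc_ring R (carrier R - P)) (loc_module R M (carrier R - P)) r)"


section \<open>The tensor product of two algebras\<close>

text \<open>
  For \<open>k\<close>-algebras \<open>A\<close> and \<open>B\<close>, the ring \<open>A \<otimes>\<^sub>k B\<close> is the quotient of the free abelian group on
  \<open>A \<times> B\<close>, with multiplication extending \<open>(a, b) (a', b') = (a a', b b')\<close>, by the relations making
  \<open>(a, b)\<close> biadditive and \<open>k\<close>-balanced. These relations are stable under multiplication by the
  generators, so the ideal they generate is the subgroup they generate.
\<close>

definition pair_ring ::
    "('k, 'a, 'd) module_scheme \<Rightarrow> ('k, 'b, 'e) module_scheme \<Rightarrow> ('a \<times> 'b \<Rightarrow>\<^sub>0 int) ring" where
  "pair_ring A B =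
     \<lparr>carrier = {c. Poly_Mapping.keys c \<subseteq> carrier A \<times> carrier B},
      mult = (\<lambda>c d. frag_extend (\<lambda>(a, b).
                frag_extend (\<lambda>(a', b'). frag_of (a \<otimes>\<^bsub>A\<^esub> a', b \<otimes>\<^bsub>B\<^esub> b')) d) c),
      one = frag_of (\<one>\<^bsub>A\<^esub>, \<one>\<^bsub>B\<^esub>),
      zero = 0,
      add = (+)\<rparr>"

definition tensor_relations ::
    "('k, 'c) ring_scheme \<Rightarrow> ('k, 'a, 'd) module_scheme \<Rightarrow> ('k, 'b, 'e) module_scheme
      \<Rightarrow> ('a \<times> 'b \<Rightarrow>\<^sub>0 int) set" where
  "tensor_relations k A B =
     {frag_of (a \<oplus>\<^bsub>A\<^esub> a', b) - frag_of (a, b) - frag_of (a', b) | a a' b.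
        a \<in> carrier A \<and> a' \<in> carrier A \<and> b \<in> carrier B} \<union>
     {frag_of (a, b \<oplus>\<^bsub>B\<^esub> b') - frag_of (a, b) - frag_of (a, b') | a b b'.
        a \<in> carrier A \<and> b \<in> carrier B \<and> b' \<in> carrier B} \<union>
     {frag_of (c \<odot>\<^bsub>A\<^esub> a, b) - frag_of (a, c \<odot>\<^bsub>B\<^esub> b) | c a b.
        c \<in> carrier k \<and> a \<in> carrier A \<and> b \<in> carrier B}"

definition tensor_ideal ::
    "('k, 'c) ring_scheme \<Rightarrow> ('k, 'a, 'd) module_scheme \<Rightarrow> ('k, 'b, 'e) module_scheme
      \<Rightarrow> ('a \<times> 'b \<Rightarrow>\<^sub>0 int) set" where
  "tensor_ideal k A B = Idl\<^bsub>pair_ring A B\<^esub> (tensor_relations k A B)"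

definition tensor ::
    "('k, 'c) ring_scheme \<Rightarrow> ('k, 'a, 'd) module_scheme \<Rightarrow> ('k, 'b, 'e) module_scheme
      \<Rightarrow> 'a \<Rightarrow> 'b \<Rightarrow> ('a \<times> 'b \<Rightarrow>\<^sub>0 int) set" where
  "tensor k A B a b = tensor_ideal k A B +>\<^bsub>pair_ring A B\<^esub> frag_of (a, b)"

text \<open>The ring \<open>A \<otimes>\<^sub>k B\<close>, with its \<open>A\<close>-module structure via \<open>a \<mapsto> a \<otimes> 1\<close>.\<close>

definition tensor_product ::
    "('k, 'c) ring_scheme \<Rightarrow> ('k, 'a, 'd) module_scheme \<Rightarrow> ('k, 'b, 'e) module_scheme
      \<Rightarrow> ('a, ('a \<times> 'b \<Rightarrow>\<^sub>0 int) set) module" where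
  "tensor_product k A B =
     (let T = pair_ring A B Quot tensor_ideal k A B
      in ring.extend T (module.fields (\<lambda>a t. tensor k A B a \<one>\<^bsub>B\<^esub> \<otimes>\<^bsub>T\<^esub> t)))"

text \<open>
  The additive map on \<open>A \<otimes>\<^sub>k B\<close> with \<open>a \<otimes> b \<mapsto> F a b\<close>; it exists uniquely whenever \<open>F\<close> is biadditive
  and \<open>k\<close>-balanced.
\<close>

definition tensor_lift ::
    "('k, 'c) ring_scheme \<Rightarrow> ('k, 'a, 'd) module_scheme \<Rightarrow> ('k, 'b, 'e) module_scheme
      \<Rightarrow> ('g, 'f) ring_scheme \<Rightarrow> ('a \<Rightarrow> 'b \<Rightarrow> 'g) \<Rightarrow> ('a \<times> 'b \<Rightarrow>\<^sub>0 int) set \<Rightarrow> 'g" where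
  "tensor_lift k A B G F =
     (THE f. f \<in> extensional (carrier (tensor_product k A B)) \<and>
        f \<in> hom (add_monoid (tensor_product k A B)) (add_monoid G) \<and>
        (\<forall>a\<in>carrier A. \<forall>b\<in>carrier B. f (tensor k A B a b) = F a b))"


section \<open>The diagonal ideal, its annihilator and the dual\<close>

definition mult_map ::
    "('k, 'c) ring_scheme \<Rightarrow> ('k, 'a, 'd) module_scheme \<Rightarrow> ('a \<times> 'a \<Rightarrow>\<^sub>0 int) set \<Rightarrow> 'a" where
  "mult_map k A = tensor_lift k A A A (\<lambda>a b. a \<otimes>\<^bsub>A\<^esub> b)"

definition diagonal_ideal ::
    "('k, 'c) ring_scheme \<Rightarrow> ('k, 'a, 'd) module_scheme \<Rightarrow> ('a \<times> 'a \<Rightarrow>\<^sub>0 int) set set" where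
  "diagonal_ideal k A = a_kernel (tensor_product k A A) A (mult_map k A)"

definition annihilator :: "('r, 'x) ring_scheme \<Rightarrow> 'r set \<Rightarrow> 'r set" where
  "annihilator R I = {x \<in> carrier R. \<forall>y\<in>I. x \<otimes>\<^bsub>R\<^esub> y = \<zero>\<^bsub>R\<^esub>}"

definition diagonal_ann ::
    "('k, 'c) ring_scheme \<Rightarrow> ('k, 'a, 'd) module_scheme \<Rightarrow> ('a \<times> 'a \<Rightarrow>\<^sub>0 int) set set" where
  "diagonal_ann k A = annihilator (tensor_product k A A) (diagonal_ideal k A)"

definition diagonal_ann_module ::
    "('k, 'c) ring_scheme \<Rightarrow> ('k, 'a, 'd) module_scheme \<Rightarrow> ('a, ('a \<times> 'a \<Rightarrow>\<^sub>0 int) set) module" where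
  "diagonal_ann_module k A = (tensor_product k A A)\<lparr>carrier := diagonal_ann k A\<rparr>"

text \<open>\<open>Hom\<^sub>k(A, k)\<close> as an \<open>A\<close>-module via \<open>(a \<phi>)(x) = \<phi>(a x)\<close>.\<close>

definition dual_module ::
    "('k, 'c) ring_scheme \<Rightarrow> ('k, 'a, 'd) module_scheme \<Rightarrow> ('a, 'a \<Rightarrow> 'k) module" where
  "dual_module k A =
     \<lparr>carrier = linear_maps k A (regular_module k),
      mult = undefined, one = undefined,
      zero = (\<lambda>x\<in>carrier A. \<zero>\<^bsub>k\<^esub>),
      add = (\<lambda>\<phi> \<psi>. \<lambda>x\<in>carrier A. \<phi> x \<oplus>\<^bsub>k\<^esub> \<psi> x),
      smult = (\<lambda>a \<phi>. \<lambda>x\<in>carrier A. \<phi> (a \<otimes>\<^bsub>A\<^esub> x))\<rparr>"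

text \<open>\<open>1 \<otimes> \<phi>\<close> sends \<open>a \<otimes> b\<close> to \<open>\<phi>(b) a\<close>.\<close>

definition one_tensor ::
    "('k, 'c) ring_scheme \<Rightarrow> ('k, 'a, 'd) module_scheme \<Rightarrow> ('a \<Rightarrow> 'k) \<Rightarrow> ('a \<times> 'a \<Rightarrow>\<^sub>0 int) set \<Rightarrow> 'a" where
  "one_tensor k A \<phi> = tensor_lift k A A A (\<lambda>a b. \<phi> b \<odot>\<^bsub>A\<^esub> a)"

definition theta0 ::
    "('k, 'c) ring_scheme \<Rightarrow> ('k, 'a, 'd) module_scheme \<Rightarrow> ('a \<Rightarrow> 'k) \<Rightarrow> ('a \<times> 'a \<Rightarrow>\<^sub>0 int) set \<Rightarrow> 'a" where
  "theta0 k A = (\<lambda>\<phi>\<in>carrier (dual_module k A). restrict (one_tensor k A \<phi>) (diagonal_ann k A))"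

end

theory Submission
  imports Defs "HOL-Algebra.Free_Abelian_Groups"
begin

text \<open>
  Let \<open>e\<^sub>i, \<epsilon>\<^sub>i\<close> be a dual basis of \<open>A\<close> over \<open>k\<close>, \<open>T = A \<otimes>\<^sub>k A\<close>, \<open>I = T \<delta>\<close> and \<open>J = T \<Delta>\<close>. Then \<open>1 \<otimes> e\<^sub>i\<close> and
  \<open>1 \<otimes> \<epsilon>\<^sub>i\<close> form a dual basis of the \<open>A\<close>-module \<open>T\<close>, and since \<open>1 \<otimes> e\<^sub>i - e\<^sub>i \<otimes> 1\<close> is a multiple of \<open>\<delta>\<close>
  there is an \<open>A\<close>-linear \<open>N : T \<rightarrow> T\<close> with \<open>\<delta> N(t) = t - \<mu>(t) \<otimes> 1\<close>. Hence \<open>\<pi>(t) = t - N(\<delta> t)\<close> is an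
  \<open>A\<close>-linear projection of \<open>T\<close> onto \<open>J\<close>, and \<open>J = A \<Delta>\<close> because \<open>I\<close> kills \<open>J\<close>.

  If \<open>c \<Delta> = 0\<close>, then \<open>c \<pi> = 0\<close>, i.e. \<open>c = c N \<delta>\<close> as endomorphisms of \<open>T\<close>; comparing traces over \<open>A\<close>,
  \<open>c tr(1) = c tr(N \<delta>) = c tr(\<delta> N) = c tr(1) - c\<close>, because \<open>t \<mapsto> \<mu>(t) \<otimes> 1\<close> has trace \<open>1\<close>. So \<open>c = 0\<close>
  and \<open>J\<close> is free on \<open>\<Delta>\<close>; it remains to see that \<open>\<phi> \<mapsto> (1 \<otimes> \<phi>)(\<Delta>)\<close> is bijective. Surjectivity holds
  because linear forms on \<open>J\<close> extend to \<open>T\<close> along \<open>\<pi>\<close>. If \<open>(1 \<otimes> \<phi>)(\<Delta>) = 0\<close>, then \<open>1 \<otimes> \<phi>\<close> vanishes on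
  \<open>J\<close> and so factors as \<open>t \<mapsto> F(\<delta> t)\<close>; under \<open>Hom\<^sub>A(T, A) = A \<otimes>\<^sub>k A\<^sup>\<or> \<rightarrow> A\<^sup>\<or>\<close>, \<open>a \<otimes> \<psi> \<mapsto> a \<psi>\<close>,
  \<open>1 \<otimes> \<phi>\<close> is sent to \<open>\<phi>\<close> on the one hand and to a multiple of \<open>\<mu>(\<delta>) = 0\<close> on the other.
\<close>

section \<open>The tensor product of two algebras\<close>

text \<open>The target is merely an additive group: balancedness compares F(c a, b) with F(a, c b)
  and asks for no action of k on \<open>G\<close>. So the same notion serves \<open>tens\<close>,
  \<mu> and 1 \<otimes> \<phi>.\<close>

definition balanced_map ::
    "('k, 'c) ring_scheme \<Rightarrow> ('k, 'a, 'd) module_scheme \<Rightarrow> ('k, 'b, 'e) module_scheme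
      \<Rightarrow> ('g, 'f) ring_scheme \<Rightarrow> ('a \<Rightarrow> 'b \<Rightarrow> 'g) \<Rightarrow> bool" where
  "balanced_map k A B G F \<longleftrightarrow>
     (\<forall>a\<in>carrier A. \<forall>b\<in>carrier B. F a b \<in> carrier G) \<and>
     (\<forall>a\<in>carrier A. \<forall>a'\<in>carrier A. \<forall>b\<in>carrier B. F (a \<oplus>\<^bsub>A\<^esub> a') b = F a b \<oplus>\<^bsub>G\<^esub> F a' b) \<and>
     (\<forall>a\<in>carrier A. \<forall>b\<in>carrier B. \<forall>b'\<in>carrier B. F a (b \<oplus>\<^bsub>B\<^esub> b') = F a b \<oplus>\<^bsub>G\<^esub> F a b') \<and>
     (\<forall>c\<in>carrier k. \<forall>a\<in>carrier A. \<forall>b\<in>carrier B. F (c \<odot>\<^bsub>A\<^esub> a) b = F a (c \<odot>\<^bsub>B\<^esub> b))"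

locale algebra_pair = A: algebra k A + B: algebra k B
  for k :: "('k, 'c) ring_scheme" and A :: "('k, 'a, 'd) module_scheme"
    and B :: "('k, 'b, 'e) module_scheme"
begin

abbreviation "P \<equiv> pair_ring A B"
abbreviation "TI \<equiv> tensor_ideal k A B"
abbreviation "T \<equiv> tensor_product k A B"
abbreviation "tens \<equiv> tensor k A B"

section \<open>The ring of formal integral combinations of pairs\<close>

lemma carrier_P: "c \<in> carrier P \<longleftrightarrow> Poly_Mapping.keys c \<subseteq> carrier A \<times> carrier B"
  by (simp add: pair_ring_def)

lemma add_P [simp]: "c \<oplus>\<^bsub>P\<^esub> d = c + d" and zero_P [simp]: "\<zero>\<^bsub>P\<^esub> = 0"
  by (simp_all add: pair_ring_def)

lemma frag_of_in_P: "a \<in> carrier A \<Longrightarrow> b \<in> carrier B \<Longrightarrow> frag_of (a, b) \<in> carrier P"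
  by (simp add: carrier_P)

lemma diff_in_P: "c \<in> carrier P \<Longrightarrow> d \<in> carrier P \<Longrightarrow> c - d \<in> carrier P"
  unfolding carrier_P using keys_diff by fastforce

lemma add_in_P: "c \<in> carrier P \<Longrightarrow> d \<in> carrier P \<Longrightarrow> c + d \<in> carrier P"
  unfolding carrier_P using keys_add by fastforce

text \<open>Closing under differences instead of sums takes care of negative coefficients without a
  separate case for negation.\<close>

lemma P_induct [consumes 1, case_names zero frag diff]:
  assumes "c \<in> carrier P" "Q 0"
    and "\<And>a b. a \<in> carrier A \<Longrightarrow> b \<in> carrier B \<Longrightarrow> Q (frag_of (a, b))"
    and "\<And>c d. \<lbrakk>c \<in> carrier P; d \<in> carrier P; Q c; Q d\<rbrakk> \<Longrightarrow> Q (c - d)"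
  shows "Q c"
  using assms(1)[unfolded carrier_P]
  by (rule free_Abelian_group_induct) (use assms(2-) in \<open>auto simp: carrier_P\<close>)

lemma mult_P: "c \<otimes>\<^bsub>P\<^esub> d = frag_extend (\<lambda>(a, b).
    frag_extend (\<lambda>(a', b'). frag_of (a \<otimes>\<^bsub>A\<^esub> a', b \<otimes>\<^bsub>B\<^esub> b')) d) c"
  by (simp add: pair_ring_def)

lemma mult_P_frag [simp]:
  "frag_of (a, b) \<otimes>\<^bsub>P\<^esub> frag_of (a', b') = frag_of (a \<otimes>\<^bsub>A\<^esub> a', b \<otimes>\<^bsub>B\<^esub> b')"
  by (simp add: mult_P)

lemma mult_P_zero [simp]: "0 \<otimes>\<^bsub>P\<^esub> d = 0" "c \<otimes>\<^bsub>P\<^esub> 0 = 0"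
  by (simp_all add: mult_P frag_extend_eq_0 split_beta)

lemma mult_P_diff_left: "(c - c') \<otimes>\<^bsub>P\<^esub> d = c \<otimes>\<^bsub>P\<^esub> d - c' \<otimes>\<^bsub>P\<^esub> d"
  by (simp add: mult_P frag_extend_diff)

text \<open>The product is defined by extension in the left factor first, so linearity there is
  immediate, while on the right it needs an induction on the left factor.\<close>

lemma mult_P_diff_right: "c \<otimes>\<^bsub>P\<^esub> (d - d') = c \<otimes>\<^bsub>P\<^esub> d - c \<otimes>\<^bsub>P\<^esub> d'"
  using subset_UNIV[of "Poly_Mapping.keys c"]
  by (induction c rule: frag_induction) (simp_all add: mult_P frag_extend_diff split_beta)

lemma mult_P_closed: "c \<in> carrier P \<Longrightarrow> d \<in> carrier P \<Longrightarrow> c \<otimes>\<^bsub>P\<^esub> d \<in> carrier P"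
proof (induction c rule: P_induct)
  case (frag a b)
  from frag(3) show ?case
    by (induction d rule: P_induct)
      (auto simp: mult_P_diff_right diff_in_P carrier_P frag(1,2) keys_diff subset_iff
            dest: subsetD[OF keys_diff])
qed (simp_all add: mult_P_diff_left diff_in_P, simp add: carrier_P)

lemma mult_P_commute: "c \<in> carrier P \<Longrightarrow> d \<in> carrier P \<Longrightarrow> c \<otimes>\<^bsub>P\<^esub> d = d \<otimes>\<^bsub>P\<^esub> c"
proof (induction c rule: P_induct)
  case (frag a b)
  from frag(3) show ?case
    by (induction d rule: P_induct)
      (simp_all add: mult_P_diff_right mult_P_diff_left frag(1,2) A.m_comm B.m_comm)
qed (simp_all add: mult_P_diff_left mult_P_diff_right)

lemma mult_P_assoc:
  assumes "c \<in> carrier P" "d \<in> carrier P" "e \<in> carrier P"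
  shows "(c \<otimes>\<^bsub>P\<^esub> d) \<otimes>\<^bsub>P\<^esub> e = c \<otimes>\<^bsub>P\<^esub> (d \<otimes>\<^bsub>P\<^esub> e)"
  using assms(1)
proof (induction c rule: P_induct)
  case (frag a b)
  from assms(2) show ?case
  proof (induction d rule: P_induct)
    case (frag a' b')
    from assms(3) show ?case
      by (induction e rule: P_induct)
        (simp_all add: mult_P_diff_right \<open>a \<in> carrier A\<close> \<open>b \<in> carrier B\<close> frag A.m_assoc B.m_assoc)
  qed (simp_all add: mult_P_diff_left mult_P_diff_right)
qed (simp_all add: mult_P_diff_left)

lemma one_P: "\<one>\<^bsub>P\<^esub> = frag_of (\<one>\<^bsub>A\<^esub>, \<one>\<^bsub>B\<^esub>)"
  by (simp add: pair_ring_def)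

lemma mult_P_one: "c \<in> carrier P \<Longrightarrow> \<one>\<^bsub>P\<^esub> \<otimes>\<^bsub>P\<^esub> c = c"
  by (induction c rule: P_induct) (simp_all add: one_P mult_P_diff_right)

lemma mult_P_add_left: "(c + c') \<otimes>\<^bsub>P\<^esub> d = c \<otimes>\<^bsub>P\<^esub> d + c' \<otimes>\<^bsub>P\<^esub> d"
  by (simp add: mult_P frag_extend_add)

lemma abelian_group_P: "abelian_group P"
proof (rule abelian_groupI)
  fix c assume "c \<in> carrier P"
  then have "- c \<in> carrier P" by (simp add: carrier_P keys_minus)
  then show "\<exists>d\<in>carrier P. d \<oplus>\<^bsub>P\<^esub> c = \<zero>\<^bsub>P\<^esub>" by (intro bexI[of _ "- c"]) simp_all
qed (simp_all add: add_in_P ac_simps, simp add: carrier_P)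

lemma cring_P: "cring P"
proof (rule cringI[OF abelian_group_P])
  show "Group.comm_monoid P"
  proof (rule comm_monoidI)
    show "\<one>\<^bsub>P\<^esub> \<in> carrier P" by (simp add: one_P frag_of_in_P)
  qed (fact mult_P_closed mult_P_assoc mult_P_one mult_P_commute)+
qed (simp add: mult_P_add_left)

sublocale P: cring P by (rule cring_P)

lemma add_monoid_P: "add_monoid P = free_Abelian_group (carrier A \<times> carrier B)"
  by (simp add: pair_ring_def free_Abelian_group_def)

lemma minus_P: "c \<in> carrier P \<Longrightarrow> \<ominus>\<^bsub>P\<^esub> c = - c"
  unfolding a_inv_def add_monoid_P by (simp add: carrier_P)

lemma minus_in_P: "c \<in> carrier P \<Longrightarrow> - c \<in> carrier P"
  by (simp add: carrier_P keys_minus)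

section \<open>The quotient by the tensor relations\<close>

lemma relations_in_P: "tensor_relations k A B \<subseteq> carrier P"
  unfolding tensor_relations_def by (auto intro!: diff_in_P frag_of_in_P)

lemma ideal_I: "ideal TI P"
  unfolding tensor_ideal_def by (rule P.genideal_ideal[OF relations_in_P])

sublocale TI: ideal TI P by (rule ideal_I)

lemma relation_in_I: "c \<in> tensor_relations k A B \<Longrightarrow> c \<in> TI"
  unfolding tensor_ideal_def using P.genideal_self[OF relations_in_P] by auto

lemma T_sel: "carrier T = carrier (P Quot TI)" "monoid.mult T = monoid.mult (P Quot TI)"
    "\<one>\<^bsub>T\<^esub> = \<one>\<^bsub>P Quot TI\<^esub>" "\<zero>\<^bsub>T\<^esub> = \<zero>\<^bsub>P Quot TI\<^esub>"
    "ring.add T = ring.add (P Quot TI)" "a \<odot>\<^bsub>T\<^esub> t = tens a \<one>\<^bsub>B\<^esub> \<otimes>\<^bsub>T\<^esub> t"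
  by (simp_all add: tensor_product_def Let_def ring.extend_def module.fields_def)

text \<open>\<open>T\<close> has the operations of \<open>P Quot TI\<close> but is a different
  record, so the ring axioms are carried over operation by operation.\<close>

lemma cring_T: "cring T"
proof -
  interpret Q: cring "P Quot TI" by (rule TI.quotient_is_cring[OF cring_P])
  show ?thesis
  proof (rule cringI)
    show "abelian_group T"
    proof (rule abelian_groupI)
      show "\<exists>y\<in>carrier T. y \<oplus>\<^bsub>T\<^esub> x = \<zero>\<^bsub>T\<^esub>" if "x \<in> carrier T" for x
        using that by (auto simp: T_sel(1-5) intro!: bexI[of _ "\<ominus>\<^bsub>P Quot TI\<^esub> x"] Q.l_neg)
    qed (simp_all only: T_sel(1-5) Q.a_ac Q.a_closed Q.zero_closed Q.l_zero Q.r_zero)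
    show "Group.comm_monoid T"
      by (rule comm_monoidI)
        (simp_all only: T_sel(1-5) Q.m_ac Q.m_closed Q.one_closed Q.l_one Q.r_one)
  qed (simp only: T_sel(1-5) Q.l_distr)
qed

sublocale T: cring T by (rule cring_T)

lemma coset_hom: "(+>\<^bsub>P\<^esub>) TI \<in> ring_hom P T"
  using TI.rcos_ring_hom by (simp add: ring_hom_def T_sel)

lemma carrier_T: "carrier T = (\<lambda>c. TI +>\<^bsub>P\<^esub> c) ` carrier P"
  unfolding T_sel FactRing_simps by auto

lemma tens_closed [simp]: "a \<in> carrier A \<Longrightarrow> b \<in> carrier B \<Longrightarrow> tens a b \<in> carrier T"
  unfolding tensor_def carrier_T by (simp add: frag_of_in_P)

lemma coset_eqI:
  assumes "c \<in> carrier P" "d \<in> carrier P" "c - d \<in> TI"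
  shows "TI +>\<^bsub>P\<^esub> c = TI +>\<^bsub>P\<^esub> d"
proof -
  have "c \<ominus>\<^bsub>P\<^esub> d = c - d" using assms(2) by (simp add: a_minus_def minus_P)
  with assms show ?thesis using P.quotient_eq_iff_same_a_r_cos[OF ideal_I, of c d] by metis
qed

lemma coset_add: "c \<in> carrier P \<Longrightarrow> d \<in> carrier P \<Longrightarrow>
    TI +>\<^bsub>P\<^esub> (c + d) = (TI +>\<^bsub>P\<^esub> c) \<oplus>\<^bsub>T\<^esub> (TI +>\<^bsub>P\<^esub> d)"
  using ring_hom_add[OF coset_hom, of c d] by simp

lemma tens_mult:
  assumes "a \<in> carrier A" "b \<in> carrier B" "a' \<in> carrier A" "b' \<in> carrier B"
  shows "tens a b \<otimes>\<^bsub>T\<^esub> tens a' b' = tens (a \<otimes>\<^bsub>A\<^esub> a') (b \<otimes>\<^bsub>B\<^esub> b')"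
  using ring_hom_mult[OF coset_hom, of "frag_of (a, b)" "frag_of (a', b')"] assms
  by (simp add: tensor_def frag_of_in_P)

lemma tens_one: "\<one>\<^bsub>T\<^esub> = tens \<one>\<^bsub>A\<^esub> \<one>\<^bsub>B\<^esub>"
  using ring_hom_one[OF coset_hom] by (simp add: tensor_def one_P)

lemma tens_balanced: "balanced_map k A B T tens"
  unfolding balanced_map_def
proof (intro conjI ballI)
  show "tens (a \<oplus>\<^bsub>A\<^esub> a') b = tens a b \<oplus>\<^bsub>T\<^esub> tens a' b"
    if "a \<in> carrier A" "a' \<in> carrier A" "b \<in> carrier B" for a a' b
    unfolding tensor_def coset_add[OF frag_of_in_P frag_of_in_P, OF that(1,3) that(2,3), symmetric]
    using that
    by (intro coset_eqI frag_of_in_P add_in_P relation_in_I)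
      (auto simp: tensor_relations_def diff_diff_add)
  show "tens a (b \<oplus>\<^bsub>B\<^esub> b') = tens a b \<oplus>\<^bsub>T\<^esub> tens a b'"
    if "a \<in> carrier A" "b \<in> carrier B" "b' \<in> carrier B" for a b b'
    unfolding tensor_def coset_add[OF frag_of_in_P frag_of_in_P, OF that(1,2) that(1,3), symmetric]
    using that
    by (intro coset_eqI frag_of_in_P add_in_P relation_in_I)
      (auto simp: tensor_relations_def diff_diff_add)
  show "tens (c \<odot>\<^bsub>A\<^esub> a) b = tens a (c \<odot>\<^bsub>B\<^esub> b)"
    if "c \<in> carrier k" "a \<in> carrier A" "b \<in> carrier B" for c a b
    unfolding tensor_def using that
    by (intro coset_eqI frag_of_in_P relation_in_I) (auto simp: tensor_relations_def)
qed simp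

lemma tens_add_left: "a \<in> carrier A \<Longrightarrow> a' \<in> carrier A \<Longrightarrow> b \<in> carrier B \<Longrightarrow>
    tens (a \<oplus>\<^bsub>A\<^esub> a') b = tens a b \<oplus>\<^bsub>T\<^esub> tens a' b"
  and tens_add_right: "a \<in> carrier A \<Longrightarrow> b \<in> carrier B \<Longrightarrow> b' \<in> carrier B \<Longrightarrow>
    tens a (b \<oplus>\<^bsub>B\<^esub> b') = tens a b \<oplus>\<^bsub>T\<^esub> tens a b'"
  and tens_smult: "c \<in> carrier k \<Longrightarrow> a \<in> carrier A \<Longrightarrow> b \<in> carrier B \<Longrightarrow>
    tens (c \<odot>\<^bsub>A\<^esub> a) b = tens a (c \<odot>\<^bsub>B\<^esub> b)"
  using tens_balanced by (simp_all add: balanced_map_def)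

lemma tens_zero_left: "b \<in> carrier B \<Longrightarrow> tens \<zero>\<^bsub>A\<^esub> b = \<zero>\<^bsub>T\<^esub>"
  using tens_add_left[of "\<zero>\<^bsub>A\<^esub>" "\<zero>\<^bsub>A\<^esub>" b] by (simp add: T.add.l_cancel_one)

lemma tens_minus_left: "a \<in> carrier A \<Longrightarrow> b \<in> carrier B \<Longrightarrow> tens (\<ominus>\<^bsub>A\<^esub> a) b = \<ominus>\<^bsub>T\<^esub> tens a b"
  using tens_add_left[of "\<ominus>\<^bsub>A\<^esub> a" a b] by (simp add: A.M.l_neg tens_zero_left T.minus_equality)

text \<open>Sums of pure tensors already exhaust \<open>T\<close>, because the negative of a
  \<otimes> b is (-a) \<otimes> b and zero is 0 \<otimes> 0; hence there is no case for
  negation.\<close>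

lemma T_induct [consumes 1, case_names tens add]:
  assumes "t \<in> carrier T"
    and tens: "\<And>a b. a \<in> carrier A \<Longrightarrow> b \<in> carrier B \<Longrightarrow> Q (tens a b)"
    and add: "\<And>s t. \<lbrakk>s \<in> carrier T; t \<in> carrier T; Q s; Q t\<rbrakk> \<Longrightarrow> Q (s \<oplus>\<^bsub>T\<^esub> t)"
  shows "Q t"
proof -
  obtain c where c: "c \<in> carrier P" "t = TI +>\<^bsub>P\<^esub> c"
    using assms(1) carrier_T by auto
  have coset: "TI +>\<^bsub>P\<^esub> d \<in> carrier T" if "d \<in> carrier P" for d
    using that carrier_T by auto
  have minus: "TI +>\<^bsub>P\<^esub> (- d) = \<ominus>\<^bsub>T\<^esub> (TI +>\<^bsub>P\<^esub> d)" if "d \<in> carrier P" for d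
    using coset_add[of d "- d"] coset_add[of 0 0] coset[OF that] coset[of 0] coset[of "- d"] that
    by (simp add: minus_in_P T.add.l_cancel_one carrier_P)
      (metis T.minus_equality T.a_comm)
  have zero: "TI +>\<^bsub>P\<^esub> 0 = tens \<zero>\<^bsub>A\<^esub> \<zero>\<^bsub>B\<^esub>"
    using minus[of 0] coset_add[of 0 0] coset[of 0]
    by (simp add: carrier_P tens_zero_left T.add.l_cancel_one)
  \<comment> \<open>A chain and its negative are treated together, since c - d has to be read as the
    sum of c and -d before \<open>add\<close> applies.\<close>
  from c(1) have "Q (TI +>\<^bsub>P\<^esub> c) \<and> Q (TI +>\<^bsub>P\<^esub> (- c))"
  proof (induction c rule: P_induct)
    case zero
    then show ?case by (simp add: \<open>TI +>\<^bsub>P\<^esub> 0 = tens \<zero>\<^bsub>A\<^esub> \<zero>\<^bsub>B\<^esub>\<close> tens)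
  next
    case (frag a b)
    then show ?case
      using tens[of a b] tens[of "\<ominus>\<^bsub>A\<^esub> a" b]
      by (simp add: minus frag_of_in_P tens_minus_left flip: tensor_def)
  next
    case (diff c d)
    have "TI +>\<^bsub>P\<^esub> (c + - d) = (TI +>\<^bsub>P\<^esub> c) \<oplus>\<^bsub>T\<^esub> (TI +>\<^bsub>P\<^esub> (- d))"
      "TI +>\<^bsub>P\<^esub> (- c + d) = (TI +>\<^bsub>P\<^esub> (- c)) \<oplus>\<^bsub>T\<^esub> (TI +>\<^bsub>P\<^esub> d)"
      by (rule coset_add[OF diff(1) minus_in_P[OF diff(2)]] coset_add[OF minus_in_P[OF diff(1)] diff(2)])+
    then have "Q (TI +>\<^bsub>P\<^esub> (c + - d))" "Q (TI +>\<^bsub>P\<^esub> (- c + d))"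
      using diff by (simp_all only:, (intro conjI add coset minus_in_P; simp)+)
    then show ?case by simp
  qed
  with c show ?thesis by simp
qed

section \<open>The universal property\<close>

lemma tensor_lift_exists:
  assumes G: "abelian_group G" and F: "balanced_map k A B G F"
  obtains f where "f \<in> extensional (carrier T)" "f \<in> hom (add_monoid T) (add_monoid G)"
    "\<And>a b. a \<in> carrier A \<Longrightarrow> b \<in> carrier B \<Longrightarrow> f (tens a b) = F a b"
proof -
  interpret G: abelian_group G by fact
  have Fc: "F a b \<in> carrier G" if "a \<in> carrier A" "b \<in> carrier B" for a b
    using F that by (simp add: balanced_map_def)
  \<comment> \<open>\<open>h\<close> is the additive extension of \<open>F\<close> to all chains; it
    descends to \<open>T\<close> once it is known to vanish on \<open>TI\<close>.\<close>
  obtain h where h: "h \<in> hom (free_Abelian_group (carrier A \<times> carrier B)) (add_monoid G)"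
    and hF: "\<And>p. p \<in> carrier A \<times> carrier B \<Longrightarrow> h (frag_of p) = case_prod F p"
    by (rule comm_group.free_Abelian_group_universal[of "add_monoid G" "case_prod F" "carrier A \<times> carrier B"])
      (use G.a_comm_group Fc in auto)
  have hc: "h c \<in> carrier G" if "c \<in> carrier P" for c
    using h that by (auto simp: hom_def carrier_P)
  have hadd: "h (c + d) = h c \<oplus>\<^bsub>G\<^esub> h d" if "c \<in> carrier P" "d \<in> carrier P" for c d
    using h that by (auto simp: hom_def carrier_P)
  have h0: "h 0 = \<zero>\<^bsub>G\<^esub>"
    using hadd[of 0 0] hc[of 0] by (simp add: carrier_P G.add.l_cancel_one)
  have hdiff: "h (c - d) = h c \<ominus>\<^bsub>G\<^esub> h d" if "c \<in> carrier P" "d \<in> carrier P" for c d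
    using hadd[of "c - d" d] that hc
    by (simp add: diff_in_P a_minus_def G.add.inv_solve_right)
  have cancel: "x \<oplus>\<^bsub>G\<^esub> (y \<oplus>\<^bsub>G\<^esub> (\<ominus>\<^bsub>G\<^esub> x \<oplus>\<^bsub>G\<^esub> \<ominus>\<^bsub>G\<^esub> y)) = \<zero>\<^bsub>G\<^esub>"
    if "x \<in> carrier G" "y \<in> carrier G" for x y
    using that G.r_neg[of "x \<oplus>\<^bsub>G\<^esub> y"] by (simp add: G.minus_add G.a_assoc)
  \<comment> \<open>The kernel of \<open>h\<close> is not visibly an ideal, so pass to the largest ideal inside it.\<close>
  define K where "K = {c \<in> carrier P. \<forall>d\<in>carrier P. h (c \<otimes>\<^bsub>P\<^esub> d) = \<zero>\<^bsub>G\<^esub>}"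
  have "ideal K P"
  proof (rule idealI[OF P.ring_axioms])
    show "subgroup K (add_monoid P)"
    proof (rule P.add.subgroupI)
      show "K \<noteq> {}" using h0 unfolding K_def by (auto intro!: exI[of _ 0] simp: carrier_P)
    next
      fix c assume c: "c \<in> K"
      then have "h (- c \<otimes>\<^bsub>P\<^esub> d) = \<zero>\<^bsub>G\<^esub>" if "d \<in> carrier P" for d
        using that hdiff[of 0 "c \<otimes>\<^bsub>P\<^esub> d"] mult_P_diff_left[of 0 c d] mult_P_closed[of c d] P.zero_closed
        by (simp add: K_def h0 a_minus_def)
      then show "\<ominus>\<^bsub>P\<^esub> c \<in> K"
        using c minus_P[of c] minus_in_P[of c] by (simp add: K_def)
    next
      fix c d assume "c \<in> K" "d \<in> K"
      then show "c \<oplus>\<^bsub>P\<^esub> d \<in> K"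
        by (simp add: K_def mult_P_add_left hadd mult_P_closed add_in_P)
    qed (auto simp: K_def)
  next
    fix c x assume c: "c \<in> K" and x: "x \<in> carrier P"
    then show "c \<otimes>\<^bsub>P\<^esub> x \<in> K" by (simp add: K_def P.m_assoc)
    with c x show "x \<otimes>\<^bsub>P\<^esub> c \<in> K" by (simp add: K_def P.m_comm)
  qed
  moreover have "tensor_relations k A B \<subseteq> K"
  proof
    fix c assume c: "c \<in> tensor_relations k A B"
    then have cP: "c \<in> carrier P" using relations_in_P by auto
    \<comment> \<open>By additivity it suffices to multiply a relation by a single pair (u, v). This
      gives another relation of the same kind, with u and v absorbed into the factors, and
      \<open>F\<close> respects it.\<close>
    have "h (c \<otimes>\<^bsub>P\<^esub> d) = \<zero>\<^bsub>G\<^esub>" if "d \<in> carrier P" for d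
      using that
    proof (induction d rule: P_induct)
      case (frag u v)
      then show ?case using c F Fc unfolding tensor_relations_def balanced_map_def
        by (auto simp: mult_P_diff_left hdiff hF frag_of_in_P diff_in_P A.l_distr B.l_distr
            A.smult_assoc2 B.smult_assoc2 a_minus_def G.minus_add G.a_ac G.r_neg cancel)
    qed (simp_all add: h0 mult_P_diff_right hdiff mult_P_closed cP a_minus_def)
    then show "c \<in> K" using cP by (simp add: K_def)
  qed
  ultimately have "TI \<subseteq> K"
    unfolding tensor_ideal_def by (rule P.genideal_minimal)
  \<comment> \<open>The multiplier 1 in the definition of \<open>K\<close> shows that
    \<open>h\<close> vanishes on \<open>K\<close>.\<close>
  then have hI: "h c = \<zero>\<^bsub>G\<^esub>" if "c \<in> TI" for c
    using that P.r_one[of c] P.one_closed unfolding K_def by fastforce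
  \<comment> \<open>A coset is evaluated at an arbitrary representative; two representatives differ
    by an element of \<open>TI\<close>, where \<open>h\<close> vanishes.\<close>
  define f where "f = (\<lambda>X\<in>carrier T. h (SOME x. x \<in> X))"
  have f: "f (TI +>\<^bsub>P\<^esub> c) = h c" if c: "c \<in> carrier P" for c
  proof -
    have "c \<in> TI +>\<^bsub>P\<^esub> c" using TI.a_rcos_self[OF c] .
    then have "(SOME x. x \<in> TI +>\<^bsub>P\<^esub> c) \<in> TI +>\<^bsub>P\<^esub> c" by (rule someI)
    then obtain i where i: "i \<in> TI" "(SOME x. x \<in> TI +>\<^bsub>P\<^esub> c) = i + c"
      by (auto simp: a_r_coset_def')
    have "i \<in> carrier P" using i(1) TI.Icarr by auto
    then show ?thesis using c hc by (auto simp: f_def i carrier_T hadd hI)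
  qed
  show thesis
  proof
    show "f \<in> extensional (carrier T)" by (simp add: f_def)
    show "f \<in> hom (add_monoid T) (add_monoid G)"
      by (rule homI) (auto simp: carrier_T f hc hadd add_in_P simp flip: coset_add)
    show "f (tens a b) = F a b" if "a \<in> carrier A" "b \<in> carrier B" for a b
      using that by (simp add: tensor_def f frag_of_in_P hF)
  qed
qed

text \<open>The definite description denotes: existence is \<open>tensor_lift_exists\<close>, and
  two additive maps that agree on pure tensors are equal by \<open>T_induct\<close>.\<close>

lemma tensor_lift:
  assumes "abelian_group G" "balanced_map k A B G F"
  defines "f \<equiv> tensor_lift k A B G F"
  shows tensor_lift_closed: "t \<in> carrier T \<Longrightarrow> f t \<in> carrier G"
    and tensor_lift_add: "s \<in> carrier T \<Longrightarrow> t \<in> carrier T \<Longrightarrow> f (s \<oplus>\<^bsub>T\<^esub> t) = f s \<oplus>\<^bsub>G\<^esub> f t"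
    and tensor_lift_tens: "a \<in> carrier A \<Longrightarrow> b \<in> carrier B \<Longrightarrow> f (tens a b) = F a b"
proof -
  let ?L = "\<lambda>f. f \<in> extensional (carrier T) \<and> f \<in> hom (add_monoid T) (add_monoid G) \<and>
    (\<forall>a\<in>carrier A. \<forall>b\<in>carrier B. f (tens a b) = F a b)"
  have "\<exists>!f. ?L f"
  proof (rule ex_ex1I)
    show "\<exists>f. ?L f" using tensor_lift_exists[OF assms(1,2)] by metis
    fix f g assume fg: "?L f" "?L g"
    show "f = g"
    proof (rule extensionalityI[of f "carrier T" g])
      fix t assume "t \<in> carrier T"
      then show "f t = g t"
        by (induction t rule: T_induct) (use fg in \<open>simp_all add: hom_def\<close>)
    qed (use fg in auto)
  qed
  then have "?L f" unfolding f_def tensor_lift_def by (rule theI')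
  then show "t \<in> carrier T \<Longrightarrow> f t \<in> carrier G"
    "s \<in> carrier T \<Longrightarrow> t \<in> carrier T \<Longrightarrow> f (s \<oplus>\<^bsub>T\<^esub> t) = f s \<oplus>\<^bsub>G\<^esub> f t"
    "a \<in> carrier A \<Longrightarrow> b \<in> carrier B \<Longrightarrow> f (tens a b) = F a b"
    by (auto simp: hom_def)
qed

end


section \<open>Linear maps\<close>

lemma (in abelian_monoid) finsum_swap:
  assumes "finite S" "finite U" "\<And>i j. i \<in> S \<Longrightarrow> j \<in> U \<Longrightarrow> f i j \<in> carrier G"
  shows "(\<Oplus>i\<in>S. \<Oplus>j\<in>U. f i j) = (\<Oplus>j\<in>U. \<Oplus>i\<in>S. f i j)"
  using assms
proof (induction S rule: finite_induct)
  case (insert i S)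
  have "(\<Oplus>j\<in>U. f i j \<oplus> (\<Oplus>i\<in>S. f i j)) = (\<Oplus>j\<in>U. f i j) \<oplus> (\<Oplus>j\<in>U. \<Oplus>i\<in>S. f i j)"
    using insert.prems by (intro finsum_addf) auto
  moreover have "(\<Oplus>j\<in>U. \<Oplus>i\<in>insert i S. f i j) = (\<Oplus>j\<in>U. f i j \<oplus> (\<Oplus>i\<in>S. f i j))"
    using insert by (intro finsum_cong') (auto simp: Pi_def)
  ultimately show ?case
    using insert by (auto simp: Pi_def)
qed simp

text \<open>Unlike membership in \<open>linear_maps\<close>, this does not ask for extensionality,
  so composites and unrestricted lambda terms qualify.\<close>

definition linear_on ::
    "('r, 'x) ring_scheme \<Rightarrow> ('r, 'm, 'y) module_scheme \<Rightarrow> ('r, 'n, 'z) module_scheme \<Rightarrow> ('m \<Rightarrow> 'n) \<Rightarrow> bool" where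
  "linear_on R M N f \<longleftrightarrow>
     (\<forall>x\<in>carrier M. f x \<in> carrier N) \<and>
     (\<forall>x\<in>carrier M. \<forall>y\<in>carrier M. f (x \<oplus>\<^bsub>M\<^esub> y) = f x \<oplus>\<^bsub>N\<^esub> f y) \<and>
     (\<forall>a\<in>carrier R. \<forall>x\<in>carrier M. f (a \<odot>\<^bsub>M\<^esub> x) = a \<odot>\<^bsub>N\<^esub> f x)"

lemma linear_maps_iff:
  "f \<in> linear_maps R M N \<longleftrightarrow> f \<in> extensional (carrier M) \<and> linear_on R M N f"
  by (auto simp: linear_maps_def linear_on_def PiE_def)

lemma regular_module_sel [simp]:
  "carrier (regular_module R) = carrier R" "\<zero>\<^bsub>regular_module R\<^esub> = \<zero>\<^bsub>R\<^esub>"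
  "x \<oplus>\<^bsub>regular_module R\<^esub> y = x \<oplus>\<^bsub>R\<^esub> y" "a \<odot>\<^bsub>regular_module R\<^esub> x = a \<otimes>\<^bsub>R\<^esub> x"
  by (simp_all add: regular_module_def)

lemma regular_module: "cring R \<Longrightarrow> module R (regular_module R)"
proof -
  assume "cring R"
  then interpret cring R .
  show ?thesis
    by (rule moduleI[OF is_cring abelian_groupI])
      (auto simp: a_ac l_distr r_distr m_assoc intro!: bexI[of _ "\<ominus>\<^bsub>R\<^esub> _"] l_neg)
qed

locale module_map = M: module R M + N: module R N
  for R :: "('r, 'x) ring_scheme" and M :: "('r, 'm, 'y) module_scheme"
    and N :: "('r, 'n, 'z) module_scheme" +
  fixes f assumes linear: "linear_on R M N f"
begin

lemma closed [simp]: "x \<in> carrier M \<Longrightarrow> f x \<in> carrier N"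
  and add: "x \<in> carrier M \<Longrightarrow> y \<in> carrier M \<Longrightarrow> f (x \<oplus>\<^bsub>M\<^esub> y) = f x \<oplus>\<^bsub>N\<^esub> f y"
  and smult: "a \<in> carrier R \<Longrightarrow> x \<in> carrier M \<Longrightarrow> f (a \<odot>\<^bsub>M\<^esub> x) = a \<odot>\<^bsub>N\<^esub> f x"
  using linear by (simp_all add: linear_on_def)

lemma zero: "f \<zero>\<^bsub>M\<^esub> = \<zero>\<^bsub>N\<^esub>"
  using smult[of "\<zero>\<^bsub>R\<^esub>" "\<zero>\<^bsub>M\<^esub>"] by simp

lemma finsum: "finite S \<Longrightarrow> g \<in> S \<rightarrow> carrier M \<Longrightarrow>
    f (\<Oplus>\<^bsub>M\<^esub>i\<in>S. g i) = (\<Oplus>\<^bsub>N\<^esub>i\<in>S. f (g i))"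
  by (induction S rule: finite_induct) (simp_all add: zero add Pi_def)

end

lemma linear_on_comp:
  "linear_on R M N f \<Longrightarrow> linear_on R L M g \<Longrightarrow> linear_on R L N (\<lambda>x. f (g x))"
  by (simp add: linear_on_def)

lemma (in abelian_group) minus_eq_zero_iff:
  assumes "x \<in> carrier G" "y \<in> carrier G"
  shows "x \<ominus> y = \<zero> \<longleftrightarrow> x = y"
  using assms minus_equality[of x "\<ominus> y"] by (auto simp: a_minus_def r_neg)

text \<open>The isomorphism sends a vector v with the single coordinate v(0) to v(0) g; it is
  injective as g has zero annihilator and surjective as g generates.\<close>

lemma free_of_rank_1:
  assumes "module R M" and g: "g \<in> carrier M"
    and inj: "\<And>a. a \<in> carrier R \<Longrightarrow> a \<odot>\<^bsub>M\<^esub> g = \<zero>\<^bsub>M\<^esub> \<Longrightarrow> a = \<zero>\<^bsub>R\<^esub>"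
    and surj: "\<And>m. m \<in> carrier M \<Longrightarrow> \<exists>a\<in>carrier R. m = a \<odot>\<^bsub>M\<^esub> g"
  shows "free_of_rank R M 1"
proof -
  interpret module R M by fact
  let ?F = "free_module R 1"
  define f where "f = (\<lambda>v\<in>carrier ?F. v 0 \<odot>\<^bsub>M\<^esub> g)"
  have carr: "carrier ?F = {..<1} \<rightarrow>\<^sub>E carrier R" by (simp add: free_module_def)
  have v0: "v 0 \<in> carrier R" if "v \<in> carrier ?F" for v
    using that unfolding carr by auto
  have "f \<in> linear_maps R ?F M"
    unfolding linear_maps_iff linear_on_def f_def using g v0
    by (auto simp: free_module_def smult_l_distr smult_assoc1)
  moreover have "bij_betw f (carrier ?F) (carrier M)"
  proof (rule bij_betwI')
    fix v w assume vw: "v \<in> carrier ?F" "w \<in> carrier ?F"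
    show "f v = f w \<longleftrightarrow> v = w"
    proof
      assume "f v = f w"
      then have "v 0 \<odot>\<^bsub>M\<^esub> g = w 0 \<odot>\<^bsub>M\<^esub> g" using vw by (simp add: f_def)
      then have "(v 0 \<ominus>\<^bsub>R\<^esub> w 0) \<odot>\<^bsub>M\<^esub> g = \<zero>\<^bsub>M\<^esub>"
        using vw g v0 by (simp add: a_minus_def smult_l_distr smult_l_minus M.r_neg)
      then have "v 0 \<ominus>\<^bsub>R\<^esub> w 0 = \<zero>\<^bsub>R\<^esub>" using vw v0 by (intro inj) auto
      then have "v 0 = w 0"
        using v0[OF vw(1)] v0[OF vw(2)] by (simp only: R.minus_eq_zero_iff)
      then show "v = w"
        using vw unfolding carr by (intro PiE_ext[of v "{..<1}" _ w]) auto
    qed simp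
  next
    show "f v \<in> carrier M" if "v \<in> carrier ?F" for v
      using that v0 g by (simp add: f_def)
  next
    fix m assume "m \<in> carrier M"
    then obtain a where a: "a \<in> carrier R" "m = a \<odot>\<^bsub>M\<^esub> g" using surj by blast
    have "(\<lambda>i\<in>{..<1}. a) \<in> carrier ?F" using a unfolding carr by auto
    moreover from this have "m = f (\<lambda>i\<in>{..<1}. a)" using a by (simp add: f_def)
    ultimately show "\<exists>v\<in>carrier ?F. m = f v" by blast
  qed
  ultimately show ?thesis
    unfolding free_of_rank_def module_iso_def using module_axioms by blast
qed


section \<open>Dual bases\<close>

text \<open>This is the coordinate form of being finitely generated and projective. The elements e_i
  need not be independent, so n need not be the rank.\<close>

locale dual_basis_algebra = algebra_pair k A A
  for k :: "('k, 'c) ring_scheme" and A :: "('k, 'a, 'd) module_scheme" +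
  fixes n :: nat and e :: "nat \<Rightarrow> 'a" and \<epsilon> :: "nat \<Rightarrow> 'a \<Rightarrow> 'k"
  assumes e_closed [simp]: "i < n \<Longrightarrow> e i \<in> carrier A"
    and eps_dual: "i < n \<Longrightarrow> \<epsilon> i \<in> linear_maps k A (regular_module k)"
    and dual_basis: "x \<in> carrier A \<Longrightarrow> (\<Oplus>\<^bsub>A\<^esub>i\<in>{..<n}. \<epsilon> i x \<odot>\<^bsub>A\<^esub> e i) = x"
begin

section \<open>T as an A-module, and the maps 1 \<otimes> \<phi> and \<mu>\<close>

abbreviation "D \<equiv> linear_maps k A (regular_module k)"
abbreviation "ot \<equiv> one_tensor k A"
abbreviation "mu \<equiv> mult_map k A"

lemma smult_T: "a \<in> carrier A \<Longrightarrow> t \<in> carrier T \<Longrightarrow> a \<odot>\<^bsub>T\<^esub> t = tens a \<one>\<^bsub>A\<^esub> \<otimes>\<^bsub>T\<^esub> t"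
  by (simp add: T_sel)

lemma module_T: "module A T"
proof (rule moduleI[OF A.M_cring T.is_abelian_group])
  show "(a \<otimes>\<^bsub>A\<^esub> b) \<odot>\<^bsub>T\<^esub> t = a \<odot>\<^bsub>T\<^esub> (b \<odot>\<^bsub>T\<^esub> t)"
    if "a \<in> carrier A" "b \<in> carrier A" "t \<in> carrier T" for a b t
    using that by (simp add: smult_T tens_mult flip: T.m_assoc)
qed (simp_all add: smult_T tens_add_left T.l_distr T.r_distr flip: tens_one)

sublocale TM: module A T by (rule module_T)

sublocale RA: module A "regular_module A" by (rule regular_module[OF A.M_cring])

lemma tens_smult_left: "a \<in> carrier A \<Longrightarrow> b \<in> carrier A \<Longrightarrow> c \<in> carrier A \<Longrightarrow>
    c \<odot>\<^bsub>T\<^esub> tens a b = tens (c \<otimes>\<^bsub>A\<^esub> a) b"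
  by (simp add: smult_T tens_mult)

lemma smult_mult_T: "a \<in> carrier A \<Longrightarrow> s \<in> carrier T \<Longrightarrow> t \<in> carrier T \<Longrightarrow>
    (a \<odot>\<^bsub>T\<^esub> s) \<otimes>\<^bsub>T\<^esub> t = a \<odot>\<^bsub>T\<^esub> (s \<otimes>\<^bsub>T\<^esub> t)"
  by (simp add: smult_T T.m_assoc)

lemma dual_closed: "\<phi> \<in> D \<Longrightarrow> x \<in> carrier A \<Longrightarrow> \<phi> x \<in> carrier k"
  and dual_add: "\<phi> \<in> D \<Longrightarrow> x \<in> carrier A \<Longrightarrow> y \<in> carrier A \<Longrightarrow> \<phi> (x \<oplus>\<^bsub>A\<^esub> y) = \<phi> x \<oplus>\<^bsub>k\<^esub> \<phi> y"
  and dual_smult: "\<phi> \<in> D \<Longrightarrow> c \<in> carrier k \<Longrightarrow> x \<in> carrier A \<Longrightarrow> \<phi> (c \<odot>\<^bsub>A\<^esub> x) = c \<otimes>\<^bsub>k\<^esub> \<phi> x"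
  by (simp_all add: linear_maps_iff linear_on_def)

lemma eps_closed [simp]: "i < n \<Longrightarrow> x \<in> carrier A \<Longrightarrow> \<epsilon> i x \<in> carrier k"
  using dual_closed[OF eps_dual] .

lemma dual_finsum:
  assumes "\<phi> \<in> D" "finite S" "g \<in> S \<rightarrow> carrier A"
  shows "\<phi> (\<Oplus>\<^bsub>A\<^esub>i\<in>S. g i) = (\<Oplus>\<^bsub>k\<^esub>i\<in>S. \<phi> (g i))"
proof -
  have "\<phi> \<zero>\<^bsub>A\<^esub> = \<zero>\<^bsub>k\<^esub>"
    using dual_smult[OF assms(1), of "\<zero>\<^bsub>k\<^esub>" "\<zero>\<^bsub>A\<^esub>"] by (simp add: dual_closed assms(1))
  with assms(2,3) show ?thesis
    by (induction S rule: finite_induct) (simp_all add: Pi_def dual_add dual_closed assms(1))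
qed

lemma smult_mult_right: "c \<in> carrier k \<Longrightarrow> x \<in> carrier A \<Longrightarrow> y \<in> carrier A \<Longrightarrow>
    x \<otimes>\<^bsub>A\<^esub> (c \<odot>\<^bsub>A\<^esub> y) = c \<odot>\<^bsub>A\<^esub> (x \<otimes>\<^bsub>A\<^esub> y)"
  by (metis A.smult_assoc2 A.m_comm A.smult_closed)

lemma balanced_ot: "\<phi> \<in> D \<Longrightarrow> balanced_map k A A A (\<lambda>a b. \<phi> b \<odot>\<^bsub>A\<^esub> a)"
  unfolding balanced_map_def
  by (auto simp: dual_closed dual_add dual_smult A.smult_l_distr A.smult_r_distr
      simp flip: A.smult_assoc1 intro: arg_cong[OF A.R.m_comm])

lemma balanced_mu: "balanced_map k A A A (\<lambda>a b. a \<otimes>\<^bsub>A\<^esub> b)"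
  unfolding balanced_map_def by (auto simp: A.l_distr A.r_distr A.smult_assoc2 smult_mult_right)

lemma ot_tens: "\<phi> \<in> D \<Longrightarrow> a \<in> carrier A \<Longrightarrow> b \<in> carrier A \<Longrightarrow> ot \<phi> (tens a b) = \<phi> b \<odot>\<^bsub>A\<^esub> a"
  unfolding one_tensor_def by (rule tensor_lift_tens[OF A.M.abelian_group_axioms balanced_ot])

lemma ot_add: "\<phi> \<in> D \<Longrightarrow> s \<in> carrier T \<Longrightarrow> t \<in> carrier T \<Longrightarrow> ot \<phi> (s \<oplus>\<^bsub>T\<^esub> t) = ot \<phi> s \<oplus>\<^bsub>A\<^esub> ot \<phi> t"
  unfolding one_tensor_def by (rule tensor_lift_add[OF A.M.abelian_group_axioms balanced_ot])

lemma ot_closed [simp]: "\<phi> \<in> D \<Longrightarrow> t \<in> carrier T \<Longrightarrow> ot \<phi> t \<in> carrier A"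
  unfolding one_tensor_def by (rule tensor_lift_closed[OF A.M.abelian_group_axioms balanced_ot])

lemma mu_tens: "a \<in> carrier A \<Longrightarrow> b \<in> carrier A \<Longrightarrow> mu (tens a b) = a \<otimes>\<^bsub>A\<^esub> b"
  unfolding mult_map_def by (rule tensor_lift_tens[OF A.M.abelian_group_axioms balanced_mu])

lemma mu_add: "s \<in> carrier T \<Longrightarrow> t \<in> carrier T \<Longrightarrow> mu (s \<oplus>\<^bsub>T\<^esub> t) = mu s \<oplus>\<^bsub>A\<^esub> mu t"
  unfolding mult_map_def by (rule tensor_lift_add[OF A.M.abelian_group_axioms balanced_mu])

lemma mu_closed [simp]: "t \<in> carrier T \<Longrightarrow> mu t \<in> carrier A"
  unfolding mult_map_def by (rule tensor_lift_closed[OF A.M.abelian_group_axioms balanced_mu])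

lemma linear_ot:
  assumes "\<phi> \<in> D"
  shows "linear_on A T (regular_module A) (ot \<phi>)"
proof -
  have "ot \<phi> (a \<odot>\<^bsub>T\<^esub> t) = a \<otimes>\<^bsub>A\<^esub> ot \<phi> t" if "a \<in> carrier A" "t \<in> carrier T" for a t
    using that(2)
    by (induction t rule: T_induct)
      (use assms that(1) in \<open>simp_all add: tens_smult_left ot_tens dual_closed smult_mult_right
        TM.smult_r_distr ot_add A.r_distr\<close>)
  then show ?thesis using assms by (simp add: linear_on_def ot_add)
qed

text \<open>\<mu> was built only as an additive map. On two pure tensors multiplicativity is
  commutativity of A, and the rest is additivity in each argument.\<close>

lemma mu_mult:
  assumes "s \<in> carrier T" "t \<in> carrier T"
  shows "mu (s \<otimes>\<^bsub>T\<^esub> t) = mu s \<otimes>\<^bsub>A\<^esub> mu t"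
  using assms(1)
proof (induction s rule: T_induct)
  case (tens a b)
  from assms(2) show ?case
    by (induction t rule: T_induct)
      (use tens in \<open>simp_all add: tens_mult mu_tens A.m_ac T.r_distr mu_add A.r_distr\<close>)
qed (use assms(2) in \<open>simp_all add: T.l_distr mu_add A.l_distr\<close>)

lemma linear_mu: "linear_on A T (regular_module A) mu"
  by (simp add: linear_on_def mu_add smult_T mu_mult mu_tens)

section \<open>The induced dual basis of T over A\<close>

definition ebar :: "nat \<Rightarrow> _" where "ebar i = tens \<one>\<^bsub>A\<^esub> (e i)"

lemma ebar_closed [simp]: "i < n \<Longrightarrow> ebar i \<in> carrier T"
  by (simp add: ebar_def)

lemma mu_ebar [simp]: "i < n \<Longrightarrow> mu (ebar i) = e i"
  by (simp add: ebar_def mu_tens)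

lemma linear_tens_left: "b \<in> carrier A \<Longrightarrow> linear_on A (regular_module A) T (\<lambda>a. tens a b)"
  by (simp add: linear_on_def tens_add_left tens_smult_left)

lemma tens_finsum_right:
  assumes "a \<in> carrier A" "finite S" "g \<in> S \<rightarrow> carrier A"
  shows "tens a (\<Oplus>\<^bsub>A\<^esub>i\<in>S. g i) = (\<Oplus>\<^bsub>T\<^esub>i\<in>S. tens a (g i))"
proof -
  have "tens a \<zero>\<^bsub>A\<^esub> = \<zero>\<^bsub>T\<^esub>"
    using tens_add_right[of a "\<zero>\<^bsub>A\<^esub>" "\<zero>\<^bsub>A\<^esub>"] assms(1) by (simp add: T.add.l_cancel_one)
  with assms(2,3) show ?thesis
    by (induction S rule: finite_induct) (simp_all add: Pi_def tens_add_right assms(1))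
qed

text \<open>Base change of the dual basis: in a \<otimes> b the right factor is written as the sum
  of the \<epsilon>_i(b) e_i, and these scalars from k move to the left factor.\<close>

lemma expand_T: "t \<in> carrier T \<Longrightarrow> (\<Oplus>\<^bsub>T\<^esub>i\<in>{..<n}. ot (\<epsilon> i) t \<odot>\<^bsub>T\<^esub> ebar i) = t"
proof (induction t rule: T_induct)
  case (tens a b)
  have "(\<Oplus>\<^bsub>T\<^esub>i\<in>{..<n}. ot (\<epsilon> i) (tens a b) \<odot>\<^bsub>T\<^esub> ebar i) = (\<Oplus>\<^bsub>T\<^esub>i\<in>{..<n}. tens a (\<epsilon> i b \<odot>\<^bsub>A\<^esub> e i))"
    using tens by (intro T.finsum_cong')
      (auto simp: ot_tens eps_dual ebar_def tens_smult_left tens_smult)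
  also have "\<dots> = tens a b"
    using tens by (subst tens_finsum_right[symmetric]) (auto simp: dual_basis)
  finally show ?case .
next
  case (add s t)
  have "(\<Oplus>\<^bsub>T\<^esub>i\<in>{..<n}. ot (\<epsilon> i) (s \<oplus>\<^bsub>T\<^esub> t) \<odot>\<^bsub>T\<^esub> ebar i)
      = (\<Oplus>\<^bsub>T\<^esub>i\<in>{..<n}. ot (\<epsilon> i) s \<odot>\<^bsub>T\<^esub> ebar i \<oplus>\<^bsub>T\<^esub> ot (\<epsilon> i) t \<odot>\<^bsub>T\<^esub> ebar i)"
    using add(1,2) by (intro T.finsum_cong') (auto simp: ot_add eps_dual TM.smult_l_distr)
  also have "\<dots> = s \<oplus>\<^bsub>T\<^esub> t"
    using add by (subst T.finsum_addf) (auto simp: eps_dual)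
  finally show ?case .
qed

text \<open>Obtained by applying f to \<open>expand_T\<close>. It replaces matrix calculations for
  maps out of T, with A or T as the target.\<close>

lemma linear_expand:
  assumes "linear_on A T N f" "module A N" "t \<in> carrier T"
  shows "f t = (\<Oplus>\<^bsub>N\<^esub>i\<in>{..<n}. ot (\<epsilon> i) t \<odot>\<^bsub>N\<^esub> f (ebar i))"
proof -
  interpret N: module A N by fact
  interpret f: module_map A T N f by unfold_locales (rule assms(1))
  have "f t = f (\<Oplus>\<^bsub>T\<^esub>i\<in>{..<n}. ot (\<epsilon> i) t \<odot>\<^bsub>T\<^esub> ebar i)"
    using assms(3) by (simp add: expand_T)
  also have "\<dots> = (\<Oplus>\<^bsub>N\<^esub>i\<in>{..<n}. f (ot (\<epsilon> i) t \<odot>\<^bsub>T\<^esub> ebar i))"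
    using assms(3) by (intro f.finsum) (auto simp: eps_dual)
  also have "\<dots> = (\<Oplus>\<^bsub>N\<^esub>i\<in>{..<n}. ot (\<epsilon> i) t \<odot>\<^bsub>N\<^esub> f (ebar i))"
    using assms(3) by (intro N.M.finsum_cong') (auto simp: eps_dual f.smult)
  finally show ?thesis .
qed

section \<open>Traces of A-linear endomorphisms of T\<close>

lemma finsum_regular: "finsum (regular_module A) g S = finsum A g S"
  by (simp add: finsum_def finprod_def regular_module_def)

definition trace :: "(('a \<times> 'a \<Rightarrow>\<^sub>0 int) set \<Rightarrow> ('a \<times> 'a \<Rightarrow>\<^sub>0 int) set) \<Rightarrow> 'a" where
  "trace f = (\<Oplus>\<^bsub>A\<^esub>i\<in>{..<n}. ot (\<epsilon> i) (f (ebar i)))"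

text \<open>Expanding the inner map in the dual basis, as in a matrix product, turns both traces
  into the same double sum up to the order of summation. Independence of the \<open>ebar i\<close>
  does not enter.\<close>

lemma trace_comm:
  assumes f: "linear_on A T T f" and g: "linear_on A T T g"
  shows "trace (\<lambda>t. f (g t)) = trace (\<lambda>t. g (f t))"
proof -
  have fc: "f t \<in> carrier T" and gc: "g t \<in> carrier T" if "t \<in> carrier T" for t
    using f g that by (simp_all add: linear_on_def)
  have expand: "ot (\<epsilon> i) (u (v (ebar i))) = (\<Oplus>\<^bsub>A\<^esub>j\<in>{..<n}. ot (\<epsilon> j) (v (ebar i)) \<otimes>\<^bsub>A\<^esub> ot (\<epsilon> i) (u (ebar j)))"
    if "i < n" "linear_on A T T u" "linear_on A T T v" for i u v
  proof -
    have "v (ebar i) \<in> carrier T" using that by (simp add: linear_on_def)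
    from linear_expand[OF linear_on_comp[OF linear_ot[OF eps_dual[OF that(1)]] that(2)] RA.module_axioms this]
    show ?thesis by (simp add: finsum_regular)
  qed
  have "trace (\<lambda>t. f (g t)) =
      (\<Oplus>\<^bsub>A\<^esub>i\<in>{..<n}. \<Oplus>\<^bsub>A\<^esub>j\<in>{..<n}. ot (\<epsilon> j) (g (ebar i)) \<otimes>\<^bsub>A\<^esub> ot (\<epsilon> i) (f (ebar j)))"
    unfolding trace_def by (intro A.finsum_cong') (auto simp: expand f g fc gc eps_dual)
  also have "\<dots> = (\<Oplus>\<^bsub>A\<^esub>j\<in>{..<n}. \<Oplus>\<^bsub>A\<^esub>i\<in>{..<n}. ot (\<epsilon> j) (g (ebar i)) \<otimes>\<^bsub>A\<^esub> ot (\<epsilon> i) (f (ebar j)))"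
    by (intro A.finsum_swap) (auto simp: fc gc eps_dual)
  also have "\<dots> = (\<Oplus>\<^bsub>A\<^esub>j\<in>{..<n}. \<Oplus>\<^bsub>A\<^esub>i\<in>{..<n}. ot (\<epsilon> i) (f (ebar j)) \<otimes>\<^bsub>A\<^esub> ot (\<epsilon> j) (g (ebar i)))"
    by (intro A.finsum_cong') (auto simp: fc gc eps_dual A.m_comm)
  also have "\<dots> = trace (\<lambda>t. g (f t))"
    unfolding trace_def by (intro A.finsum_cong') (auto simp: expand f g fc gc eps_dual)
  finally show ?thesis .
qed

section \<open>Contraction of linear forms on T to linear forms on A\<close>

text \<open>
  The image of \<open>\<Sum>\<^sub>i g\<^sub>i \<otimes> \<epsilon>\<^sub>i\<close> under \<open>A \<otimes>\<^sub>k A\<^sup>\<or> \<rightarrow> A\<^sup>\<or>\<close>, \<open>a \<otimes> \<psi> \<mapsto> a \<psi>\<close>.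
\<close>

definition contraction :: "(nat \<Rightarrow> 'a) \<Rightarrow> 'a \<Rightarrow> 'k" where
  "contraction g = (\<lambda>y\<in>carrier A. \<Oplus>\<^bsub>k\<^esub>i\<in>{..<n}. \<epsilon> i (g i \<otimes>\<^bsub>A\<^esub> y))"

lemma contraction_dual:
  assumes g: "\<And>i. i < n \<Longrightarrow> g i \<in> carrier A"
  shows "contraction g \<in> D"
proof -
  have "contraction g (y \<oplus>\<^bsub>A\<^esub> z) = contraction g y \<oplus>\<^bsub>k\<^esub> contraction g z"
    if "y \<in> carrier A" "z \<in> carrier A" for y z
  proof -
    have "contraction g (y \<oplus>\<^bsub>A\<^esub> z) = (\<Oplus>\<^bsub>k\<^esub>i\<in>{..<n}. \<epsilon> i (g i \<otimes>\<^bsub>A\<^esub> (y \<oplus>\<^bsub>A\<^esub> z)))"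
      using that by (simp add: contraction_def)
    also have "\<dots> = (\<Oplus>\<^bsub>k\<^esub>i\<in>{..<n}. \<epsilon> i (g i \<otimes>\<^bsub>A\<^esub> y) \<oplus>\<^bsub>k\<^esub> \<epsilon> i (g i \<otimes>\<^bsub>A\<^esub> z))"
      using that g by (intro A.R.finsum_cong') (auto simp: A.r_distr dual_add[OF eps_dual])
    also have "\<dots> = contraction g y \<oplus>\<^bsub>k\<^esub> contraction g z"
      using that g by (subst A.R.finsum_addf) (auto simp: contraction_def)
    finally show ?thesis .
  qed
  moreover have "contraction g (c \<odot>\<^bsub>A\<^esub> y) = c \<otimes>\<^bsub>k\<^esub> contraction g y"
    if "c \<in> carrier k" "y \<in> carrier A" for c y
  proof -
    have "contraction g (c \<odot>\<^bsub>A\<^esub> y) = (\<Oplus>\<^bsub>k\<^esub>i\<in>{..<n}. c \<otimes>\<^bsub>k\<^esub> \<epsilon> i (g i \<otimes>\<^bsub>A\<^esub> y))"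
      unfolding contraction_def using that g
      by (auto intro!: A.R.finsum_cong' simp: smult_mult_right dual_smult[OF eps_dual])
    also have "\<dots> = c \<otimes>\<^bsub>k\<^esub> contraction g y"
      using that g by (subst A.R.finsum_rdistr[symmetric]) (auto simp: contraction_def)
    finally show ?thesis .
  qed
  ultimately show ?thesis
    using g by (auto simp: linear_maps_iff linear_on_def contraction_def intro!: A.R.finsum_closed)
qed

lemma smult_finsum_left:
  assumes "finite S" "a \<in> carrier A" "c \<in> S \<rightarrow> carrier k"
  shows "(\<Oplus>\<^bsub>k\<^esub>i\<in>S. c i) \<odot>\<^bsub>A\<^esub> a = (\<Oplus>\<^bsub>A\<^esub>i\<in>S. c i \<odot>\<^bsub>A\<^esub> a)"
  using assms(1,3) by (induction S rule: finite_induct) (simp_all add: Pi_def A.smult_l_distr assms(2))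

text \<open>On a \<otimes> b both sides are the sum of the \<epsilon>_i(g_i b) a. The formula is
  meant for t in J, where 1 \<otimes> g_i acts as the scalar g_i.\<close>

lemma ot_contraction:
  assumes g: "\<And>i. i < n \<Longrightarrow> g i \<in> carrier A" and "t \<in> carrier T"
  shows "ot (contraction g) t = (\<Oplus>\<^bsub>A\<^esub>i\<in>{..<n}. ot (\<epsilon> i) (tens \<one>\<^bsub>A\<^esub> (g i) \<otimes>\<^bsub>T\<^esub> t))"
  using assms(2)
proof (induction t rule: T_induct)
  case (tens a b)
  have "(\<Oplus>\<^bsub>A\<^esub>i\<in>{..<n}. ot (\<epsilon> i) (tens \<one>\<^bsub>A\<^esub> (g i) \<otimes>\<^bsub>T\<^esub> tens a b))
      = (\<Oplus>\<^bsub>A\<^esub>i\<in>{..<n}. \<epsilon> i (g i \<otimes>\<^bsub>A\<^esub> b) \<odot>\<^bsub>A\<^esub> a)"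
    using tens g by (intro A.finsum_cong') (auto simp: tens_mult ot_tens eps_dual)
  also have "\<dots> = ot (contraction g) (tens a b)"
    using tens g by (subst smult_finsum_left[symmetric])
      (auto simp: ot_tens contraction_dual, simp add: contraction_def)
  finally show ?case ..
next
  case (add s t)
  have "(\<Oplus>\<^bsub>A\<^esub>i\<in>{..<n}. ot (\<epsilon> i) (tens \<one>\<^bsub>A\<^esub> (g i) \<otimes>\<^bsub>T\<^esub> (s \<oplus>\<^bsub>T\<^esub> t)))
      = (\<Oplus>\<^bsub>A\<^esub>i\<in>{..<n}. ot (\<epsilon> i) (tens \<one>\<^bsub>A\<^esub> (g i) \<otimes>\<^bsub>T\<^esub> s) \<oplus>\<^bsub>A\<^esub> ot (\<epsilon> i) (tens \<one>\<^bsub>A\<^esub> (g i) \<otimes>\<^bsub>T\<^esub> t))"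
    using add(1,2) g by (intro A.finsum_cong') (auto simp: ot_add eps_dual T.r_distr)
  also have "\<dots> = ot (contraction g) (s \<oplus>\<^bsub>T\<^esub> t)"
    using add g by (subst A.finsum_addf) (auto simp: eps_dual ot_add contraction_dual)
  finally show ?case ..
qed

text \<open>The map \<open>Hom\<^sub>A(T, A) \<rightarrow> A\<^sup>\<or>\<close> is \<open>T\<close>-linear, with \<open>T\<close> acting on \<open>A\<^sup>\<or>\<close> through \<open>\<mu>\<close>.\<close>

lemma contraction_mult:
  assumes f: "linear_on A T (regular_module A) f" and "t \<in> carrier T" and y: "y \<in> carrier A"
  shows "contraction (\<lambda>i. f (t \<otimes>\<^bsub>T\<^esub> ebar i)) y = contraction (\<lambda>i. f (ebar i)) (mu t \<otimes>\<^bsub>A\<^esub> y)"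
proof -
  have fc [simp]: "f t \<in> carrier A" if "t \<in> carrier T" for t
    using f that by (simp add: linear_on_def)
  have fadd: "f (s \<oplus>\<^bsub>T\<^esub> t) = f s \<oplus>\<^bsub>A\<^esub> f t" if "s \<in> carrier T" "t \<in> carrier T" for s t
    using f that by (simp add: linear_on_def)
  from assms(2) show ?thesis
  proof (induction t rule: T_induct)
    case (tens u v)
    let ?z = "\<lambda>l. u \<otimes>\<^bsub>A\<^esub> f (ebar l) \<otimes>\<^bsub>A\<^esub> y"
    have z [simp]: "?z l \<in> carrier A" if "l < n" for l using tens y that by simp
    \<comment> \<open>Expanding u \<otimes> v e_i in the dual basis leaves f evaluated only at the
      \<open>ebar l\<close>, with scalars \<epsilon>_l(v e_i) in k that can later be pulled out of
      \<epsilon>_i.\<close>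
    have "f (tens u v \<otimes>\<^bsub>T\<^esub> ebar i) \<otimes>\<^bsub>A\<^esub> y = (\<Oplus>\<^bsub>A\<^esub>l\<in>{..<n}. \<epsilon> l (v \<otimes>\<^bsub>A\<^esub> e i) \<odot>\<^bsub>A\<^esub> ?z l)" if "i < n" for i
    proof -
      have "f (tens u v \<otimes>\<^bsub>T\<^esub> ebar i) = f (tens u (v \<otimes>\<^bsub>A\<^esub> e i))"
        using tens that by (simp add: ebar_def tens_mult)
      also have "\<dots> = (\<Oplus>\<^bsub>A\<^esub>l\<in>{..<n}. ot (\<epsilon> l) (tens u (v \<otimes>\<^bsub>A\<^esub> e i)) \<otimes>\<^bsub>A\<^esub> f (ebar l))"
        using linear_expand[OF f RA.module_axioms, of "tens u (v \<otimes>\<^bsub>A\<^esub> e i)"] tens that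
        by (simp add: finsum_regular)
      finally have "f (tens u v \<otimes>\<^bsub>T\<^esub> ebar i) \<otimes>\<^bsub>A\<^esub> y =
          (\<Oplus>\<^bsub>A\<^esub>l\<in>{..<n}. ot (\<epsilon> l) (tens u (v \<otimes>\<^bsub>A\<^esub> e i)) \<otimes>\<^bsub>A\<^esub> f (ebar l) \<otimes>\<^bsub>A\<^esub> y)"
        using tens that y by (simp add: A.finsum_ldistr eps_dual Pi_def)
      also have "\<dots> = (\<Oplus>\<^bsub>A\<^esub>l\<in>{..<n}. \<epsilon> l (v \<otimes>\<^bsub>A\<^esub> e i) \<odot>\<^bsub>A\<^esub> ?z l)"
        using tens that y by (intro A.finsum_cong') (auto simp: ot_tens eps_dual A.smult_assoc2)
      finally show ?thesis .
    qed
    then have "\<epsilon> i (f (tens u v \<otimes>\<^bsub>T\<^esub> ebar i) \<otimes>\<^bsub>A\<^esub> y)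
        = (\<Oplus>\<^bsub>k\<^esub>l\<in>{..<n}. \<epsilon> l (v \<otimes>\<^bsub>A\<^esub> e i) \<otimes>\<^bsub>k\<^esub> \<epsilon> i (?z l))" if "i < n" for i
      using that tens y by (simp add: dual_finsum eps_dual Pi_def)
        (intro A.R.finsum_cong', auto simp: eps_dual dual_smult)
    then have "contraction (\<lambda>i. f (tens u v \<otimes>\<^bsub>T\<^esub> ebar i)) y
        = (\<Oplus>\<^bsub>k\<^esub>i\<in>{..<n}. \<Oplus>\<^bsub>k\<^esub>l\<in>{..<n}. \<epsilon> l (v \<otimes>\<^bsub>A\<^esub> e i) \<otimes>\<^bsub>k\<^esub> \<epsilon> i (?z l))"
      using tens y by (auto simp: contraction_def intro!: A.R.finsum_cong' A.R.finsum_closed)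
    also have "\<dots> = (\<Oplus>\<^bsub>k\<^esub>l\<in>{..<n}. \<Oplus>\<^bsub>k\<^esub>i\<in>{..<n}. \<epsilon> l (v \<otimes>\<^bsub>A\<^esub> e i) \<otimes>\<^bsub>k\<^esub> \<epsilon> i (?z l))"
      using tens y by (intro A.R.finsum_swap) auto
    also have "\<dots> = (\<Oplus>\<^bsub>k\<^esub>l\<in>{..<n}. \<epsilon> l (f (ebar l) \<otimes>\<^bsub>A\<^esub> (u \<otimes>\<^bsub>A\<^esub> v \<otimes>\<^bsub>A\<^esub> y)))"
    proof (rule A.R.finsum_cong')
      fix l assume l: "l \<in> {..<n}"
      \<comment> \<open>The sum over i reassembles \<open>?z l\<close> from its coordinates
        \<epsilon>_i, which moves the factor v next to it inside \<epsilon>_l.\<close>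
      have "v \<otimes>\<^bsub>A\<^esub> ?z l = v \<otimes>\<^bsub>A\<^esub> (\<Oplus>\<^bsub>A\<^esub>i\<in>{..<n}. \<epsilon> i (?z l) \<odot>\<^bsub>A\<^esub> e i)"
        using l by (simp add: dual_basis)
      also have "\<dots> = (\<Oplus>\<^bsub>A\<^esub>i\<in>{..<n}. v \<otimes>\<^bsub>A\<^esub> (\<epsilon> i (?z l) \<odot>\<^bsub>A\<^esub> e i))"
        using tens l by (intro A.finsum_rdistr) auto
      also have "\<dots> = (\<Oplus>\<^bsub>A\<^esub>i\<in>{..<n}. \<epsilon> i (?z l) \<odot>\<^bsub>A\<^esub> (v \<otimes>\<^bsub>A\<^esub> e i))"
        using tens l by (intro A.finsum_cong') (auto simp: smult_mult_right)
      finally have "\<epsilon> l (v \<otimes>\<^bsub>A\<^esub> ?z l) = (\<Oplus>\<^bsub>k\<^esub>i\<in>{..<n}. \<epsilon> i (?z l) \<otimes>\<^bsub>k\<^esub> \<epsilon> l (v \<otimes>\<^bsub>A\<^esub> e i))"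
        using tens l by (simp add: dual_finsum eps_dual Pi_def)
          (intro A.R.finsum_cong', auto simp: eps_dual dual_smult)
      also have "\<dots> = (\<Oplus>\<^bsub>k\<^esub>i\<in>{..<n}. \<epsilon> l (v \<otimes>\<^bsub>A\<^esub> e i) \<otimes>\<^bsub>k\<^esub> \<epsilon> i (?z l))"
        using tens l by (intro A.R.finsum_cong') (auto simp: A.R.m_comm)
      also have "v \<otimes>\<^bsub>A\<^esub> ?z l = f (ebar l) \<otimes>\<^bsub>A\<^esub> (u \<otimes>\<^bsub>A\<^esub> v \<otimes>\<^bsub>A\<^esub> y)"
        using tens l y by (simp add: A.m_ac)
      finally show "(\<Oplus>\<^bsub>k\<^esub>i\<in>{..<n}. \<epsilon> l (v \<otimes>\<^bsub>A\<^esub> e i) \<otimes>\<^bsub>k\<^esub> \<epsilon> i (?z l))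
          = \<epsilon> l (f (ebar l) \<otimes>\<^bsub>A\<^esub> (u \<otimes>\<^bsub>A\<^esub> v \<otimes>\<^bsub>A\<^esub> y))" ..
    qed (use tens y in auto)
    also have "\<dots> = contraction (\<lambda>i. f (ebar i)) (mu (tens u v) \<otimes>\<^bsub>A\<^esub> y)"
      using tens y by (simp add: contraction_def mu_tens)
    finally show ?case .
  next
    case (add s t)
    have "contraction (\<lambda>i. f ((s \<oplus>\<^bsub>T\<^esub> t) \<otimes>\<^bsub>T\<^esub> ebar i)) y
        = (\<Oplus>\<^bsub>k\<^esub>i\<in>{..<n}. \<epsilon> i (f ((s \<oplus>\<^bsub>T\<^esub> t) \<otimes>\<^bsub>T\<^esub> ebar i) \<otimes>\<^bsub>A\<^esub> y))"
      using y by (simp add: contraction_def)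
    also have "\<dots> = (\<Oplus>\<^bsub>k\<^esub>i\<in>{..<n}. \<epsilon> i (f (s \<otimes>\<^bsub>T\<^esub> ebar i) \<otimes>\<^bsub>A\<^esub> y) \<oplus>\<^bsub>k\<^esub> \<epsilon> i (f (t \<otimes>\<^bsub>T\<^esub> ebar i) \<otimes>\<^bsub>A\<^esub> y))"
      using add(1,2) y
      by (intro A.R.finsum_cong') (auto simp: T.l_distr fadd A.l_distr dual_add[OF eps_dual])
    also have "\<dots> = contraction (\<lambda>i. f (s \<otimes>\<^bsub>T\<^esub> ebar i)) y \<oplus>\<^bsub>k\<^esub> contraction (\<lambda>i. f (t \<otimes>\<^bsub>T\<^esub> ebar i)) y"
      using add(1,2) y by (subst A.R.finsum_addf) (auto simp: contraction_def)
    also have "\<dots> = contraction (\<lambda>i. f (ebar i)) (mu (s \<oplus>\<^bsub>T\<^esub> t) \<otimes>\<^bsub>A\<^esub> y)"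
      using add y contraction_dual[of "\<lambda>i. f (ebar i)"]
      by (simp add: mu_add A.l_distr dual_add)
    finally show ?case .
  qed
qed

text \<open>The coefficients are the values of 1 \<otimes> \<phi> at the \<open>ebar i\<close>, so
  contraction undoes the passage from \<phi> to 1 \<otimes> \<phi>. This is \<phi> applied to the
  dual basis expansion of y.\<close>

lemma contraction_const:
  assumes "\<phi> \<in> D"
  shows "contraction (\<lambda>i. \<phi> (e i) \<odot>\<^bsub>A\<^esub> \<one>\<^bsub>A\<^esub>) = \<phi>"
proof (rule extensionalityI)
  fix y assume y: "y \<in> carrier A"
  have "\<phi> y = \<phi> (\<Oplus>\<^bsub>A\<^esub>i\<in>{..<n}. \<epsilon> i y \<odot>\<^bsub>A\<^esub> e i)"
    using y by (simp add: dual_basis)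
  also have "\<dots> = (\<Oplus>\<^bsub>k\<^esub>i\<in>{..<n}. \<epsilon> i y \<otimes>\<^bsub>k\<^esub> \<phi> (e i))"
    using y assms by (subst dual_finsum)
      (auto simp: dual_smult dual_closed intro!: A.R.finsum_cong')
  also have "\<dots> = contraction (\<lambda>i. \<phi> (e i) \<odot>\<^bsub>A\<^esub> \<one>\<^bsub>A\<^esub>) y"
    using y assms
    by (auto simp: contraction_def A.smult_assoc2 dual_smult eps_dual dual_closed A.R.m_comm
        intro!: A.R.finsum_cong')
  finally show "contraction (\<lambda>i. \<phi> (e i) \<odot>\<^bsub>A\<^esub> \<one>\<^bsub>A\<^esub>) y = \<phi> y" ..
qed (use assms in \<open>auto simp: contraction_def linear_maps_iff\<close>)

end

section \<open>The dual of A as an A-module\<close>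

context dual_basis_algebra begin

abbreviation "DM \<equiv> dual_module k A"
abbreviation "J \<equiv> diagonal_ann k A"
abbreviation "JM \<equiv> diagonal_ann_module k A"

lemma carrier_DM [simp]: "carrier DM = D"
  and DM_zero: "y \<in> carrier A \<Longrightarrow> \<zero>\<^bsub>DM\<^esub> y = \<zero>\<^bsub>k\<^esub>"
  and DM_add: "y \<in> carrier A \<Longrightarrow> (\<phi> \<oplus>\<^bsub>DM\<^esub> \<psi>) y = \<phi> y \<oplus>\<^bsub>k\<^esub> \<psi> y"
  and DM_smult: "y \<in> carrier A \<Longrightarrow> (a \<odot>\<^bsub>DM\<^esub> \<phi>) y = \<phi> (a \<otimes>\<^bsub>A\<^esub> y)"
  by (simp_all add: dual_module_def)

lemma DM_ext: "\<zero>\<^bsub>DM\<^esub> \<in> extensional (carrier A)" "\<phi> \<oplus>\<^bsub>DM\<^esub> \<psi> \<in> extensional (carrier A)"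
    "a \<odot>\<^bsub>DM\<^esub> \<phi> \<in> extensional (carrier A)"
  by (simp_all add: dual_module_def)

lemma dualI:
  assumes "f \<in> extensional (carrier A)"
    "\<And>y. y \<in> carrier A \<Longrightarrow> f y \<in> carrier k"
    "\<And>y z. y \<in> carrier A \<Longrightarrow> z \<in> carrier A \<Longrightarrow> f (y \<oplus>\<^bsub>A\<^esub> z) = f y \<oplus>\<^bsub>k\<^esub> f z"
    "\<And>c y. c \<in> carrier k \<Longrightarrow> y \<in> carrier A \<Longrightarrow> f (c \<odot>\<^bsub>A\<^esub> y) = c \<otimes>\<^bsub>k\<^esub> f y"
  shows "f \<in> D"
  using assms by (simp add: linear_maps_iff linear_on_def)

lemma dual_eqI: "\<phi> \<in> D \<Longrightarrow> \<psi> \<in> D \<Longrightarrow> (\<And>y. y \<in> carrier A \<Longrightarrow> \<phi> y = \<psi> y) \<Longrightarrow> \<phi> = \<psi>"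
  by (rule extensionalityI[of _ "carrier A"]) (auto simp: linear_maps_iff)

lemma DM_add_closed [simp]: "\<phi> \<in> D \<Longrightarrow> \<psi> \<in> D \<Longrightarrow> \<phi> \<oplus>\<^bsub>DM\<^esub> \<psi> \<in> D"
  by (rule dualI) (auto simp: DM_ext DM_add dual_closed dual_add dual_smult A.R.a_ac A.R.r_distr)

lemma DM_smult_closed [simp]: "a \<in> carrier A \<Longrightarrow> \<phi> \<in> D \<Longrightarrow> a \<odot>\<^bsub>DM\<^esub> \<phi> \<in> D"
  by (rule dualI) (auto simp: DM_ext DM_smult dual_closed dual_add dual_smult A.r_distr smult_mult_right)

lemma DM_zero_closed [simp]: "\<zero>\<^bsub>DM\<^esub> \<in> D"
  by (rule dualI) (auto simp: DM_ext DM_zero)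

lemma module_DM: "module A DM"
proof (rule moduleI[OF A.M_cring])
  show "abelian_group DM"
  proof (rule abelian_groupI)
    fix \<phi> assume \<phi>: "\<phi> \<in> carrier DM"
    define \<psi> where "\<psi> = (\<lambda>y\<in>carrier A. \<ominus>\<^bsub>k\<^esub> \<phi> y)"
    have "\<psi> \<in> D"
      using \<phi> by (intro dualI)
        (auto simp: \<psi>_def dual_closed dual_add dual_smult A.R.minus_add A.R.r_minus)
    moreover from this have "\<psi> \<oplus>\<^bsub>DM\<^esub> \<phi> = \<zero>\<^bsub>DM\<^esub>"
      using \<phi> by (intro dual_eqI) (auto simp: DM_add DM_zero \<psi>_def dual_closed A.R.l_neg)
    ultimately show "\<exists>\<psi>\<in>carrier DM. \<psi> \<oplus>\<^bsub>DM\<^esub> \<phi> = \<zero>\<^bsub>DM\<^esub>" by auto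
  qed (auto intro!: dual_eqI simp: DM_add DM_zero dual_closed A.R.a_ac)
qed (auto intro!: dual_eqI simp: DM_add DM_smult dual_closed dual_add A.l_distr A.r_distr A.m_ac)

sublocale DM: module A DM by (rule module_DM)

lemma ot_DM_add:
  assumes "\<phi> \<in> D" "\<psi> \<in> D" "t \<in> carrier T"
  shows "ot (\<phi> \<oplus>\<^bsub>DM\<^esub> \<psi>) t = ot \<phi> t \<oplus>\<^bsub>A\<^esub> ot \<psi> t"
  using assms(3)
proof (induction t rule: T_induct)
  case (tens a b)
  then show ?case
    using assms(1,2) by (simp add: ot_tens DM_add dual_closed A.smult_l_distr)
next
  case (add s t)
  then show ?case
    using assms(1,2) by (simp add: ot_add A.M.a_ac)
qed

text \<open>The action on the dual enters through the second tensor factor, whereas T is an A-module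
  through the first; on J the two are reconciled by \<open>mult_J\<close>.\<close>

lemma ot_DM_smult:
  assumes "\<phi> \<in> D" "a \<in> carrier A" "t \<in> carrier T"
  shows "ot (a \<odot>\<^bsub>DM\<^esub> \<phi>) t = ot \<phi> (tens \<one>\<^bsub>A\<^esub> a \<otimes>\<^bsub>T\<^esub> t)"
  using assms(3)
proof (induction t rule: T_induct)
  case (tens b c)
  then show ?case
    using assms(1,2) by (simp add: ot_tens DM_smult tens_mult)
next
  case (add s t)
  then show ?case
    using assms(1,2) by (simp add: ot_add T.r_distr)
qed

lemma diagonal_ideal_iff: "t \<in> diagonal_ideal k A \<longleftrightarrow> t \<in> carrier T \<and> mu t = \<zero>\<^bsub>A\<^esub>"
  by (simp add: diagonal_ideal_def a_kernel_def kernel_def)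

end


section \<open>Principal diagonal ideal and annihilator\<close>

locale principal_diagonal = dual_basis_algebra +
  fixes \<delta> \<Delta>
  assumes delta [simp]: "\<delta> \<in> carrier T"
    and diagonal_ideal: "diagonal_ideal k A = {t \<otimes>\<^bsub>T\<^esub> \<delta> | t. t \<in> carrier T}"
    and Delta [simp]: "\<Delta> \<in> carrier T"
    and diagonal_ann: "J = {t \<otimes>\<^bsub>T\<^esub> \<Delta> | t. t \<in> carrier T}"
begin

lemma mu_delta: "mu \<delta> = \<zero>\<^bsub>A\<^esub>"
proof -
  have "\<delta> \<in> diagonal_ideal k A"
    unfolding diagonal_ideal by (intro CollectI exI[of _ "\<one>\<^bsub>T\<^esub>"]) simp
  then show ?thesis by (simp add: diagonal_ideal_iff)
qed

lemma delta_dvd: "t \<in> carrier T \<Longrightarrow> mu t = \<zero>\<^bsub>A\<^esub> \<Longrightarrow> \<exists>s\<in>carrier T. s \<otimes>\<^bsub>T\<^esub> \<delta> = t"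
  using diagonal_ideal_iff[of t] unfolding diagonal_ideal by blast

text \<open>An element kills the ideal I as soon as it kills the generator \<delta>.\<close>

lemma J_iff: "t \<in> J \<longleftrightarrow> t \<in> carrier T \<and> t \<otimes>\<^bsub>T\<^esub> \<delta> = \<zero>\<^bsub>T\<^esub>"
proof -
  have "t \<otimes>\<^bsub>T\<^esub> y = \<zero>\<^bsub>T\<^esub>" if t: "t \<in> carrier T" "t \<otimes>\<^bsub>T\<^esub> \<delta> = \<zero>\<^bsub>T\<^esub>" and "y \<in> diagonal_ideal k A" for y
  proof -
    obtain s where "s \<in> carrier T" "y = s \<otimes>\<^bsub>T\<^esub> \<delta>" using \<open>y \<in> _\<close> unfolding diagonal_ideal by blast
    then show ?thesis using t by (simp add: T.m_lcomm)
  qed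
  moreover have "\<delta> \<in> diagonal_ideal k A" by (simp add: diagonal_ideal_iff mu_delta)
  ultimately show ?thesis unfolding diagonal_ann_def annihilator_def by blast
qed

lemma Delta_in_J [simp]: "\<Delta> \<in> J"
proof -
  show ?thesis
    unfolding diagonal_ann by (intro CollectI exI[of _ "\<one>\<^bsub>T\<^esub>"]) simp
qed

lemma mu_diff: "s \<in> carrier T \<Longrightarrow> t \<in> carrier T \<Longrightarrow> mu (s \<ominus>\<^bsub>T\<^esub> t) = mu s \<ominus>\<^bsub>A\<^esub> mu t"
  using mu_add[of "s \<ominus>\<^bsub>T\<^esub> t" t]
  by (simp add: a_minus_def T.a_assoc T.l_neg A.M.a_assoc A.M.r_neg)

text \<open>The difference of t and \<mu>(t) \<otimes> 1 has \<mu>-value zero, so it lies in I and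
  kills J. In particular a \<otimes> 1 and 1 \<otimes> a act alike on J.\<close>

lemma mult_J:
  assumes "t \<in> carrier T" "j \<in> J"
  shows "t \<otimes>\<^bsub>T\<^esub> j = mu t \<odot>\<^bsub>T\<^esub> j"
proof -
  have j: "j \<in> carrier T" "j \<otimes>\<^bsub>T\<^esub> \<delta> = \<zero>\<^bsub>T\<^esub>" using assms(2) by (simp_all add: J_iff)
  let ?d = "t \<ominus>\<^bsub>T\<^esub> tens (mu t) \<one>\<^bsub>A\<^esub>"
  have "mu ?d = \<zero>\<^bsub>A\<^esub>"
    using assms by (simp add: mu_diff mu_tens A.M.minus_eq_zero_iff)
  then obtain s where "s \<in> carrier T" "s \<otimes>\<^bsub>T\<^esub> \<delta> = ?d"
    using delta_dvd[of ?d] assms by auto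
  then have "?d \<otimes>\<^bsub>T\<^esub> j = s \<otimes>\<^bsub>T\<^esub> (j \<otimes>\<^bsub>T\<^esub> \<delta>)"
    using j \<open>s \<in> carrier T\<close> by (metis T.m_assoc T.m_comm delta)
  also have "\<dots> = \<zero>\<^bsub>T\<^esub>"
    using j by (simp add: J_iff \<open>s \<in> carrier T\<close>)
  finally have "t \<otimes>\<^bsub>T\<^esub> j \<ominus>\<^bsub>T\<^esub> mu t \<odot>\<^bsub>T\<^esub> j = \<zero>\<^bsub>T\<^esub>"
    using assms j by (simp add: a_minus_def T.l_distr T.l_minus smult_T)
  then show ?thesis using assms j by (simp add: T.minus_eq_zero_iff)
qed

section \<open>The projection of T onto J\<close>

definition diag_quot where
  "diag_quot i = (SOME m. m \<in> carrier T \<and> m \<otimes>\<^bsub>T\<^esub> \<delta> = ebar i \<ominus>\<^bsub>T\<^esub> tens (e i) \<one>\<^bsub>A\<^esub>)"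

text \<open>The right-hand side is in the kernel of \<mu>, hence a multiple of \<delta>. The
  quotient is determined only up to J, which is why one is chosen.\<close>

lemma diag_quot:
  assumes "i < n"
  shows diag_quot_closed [simp]: "diag_quot i \<in> carrier T"
    and diag_quot_delta: "diag_quot i \<otimes>\<^bsub>T\<^esub> \<delta> = ebar i \<ominus>\<^bsub>T\<^esub> tens (e i) \<one>\<^bsub>A\<^esub>"
proof -
  have "mu (ebar i \<ominus>\<^bsub>T\<^esub> tens (e i) \<one>\<^bsub>A\<^esub>) = \<zero>\<^bsub>A\<^esub>"
    using assms by (simp add: mu_diff mu_tens A.M.minus_eq_zero_iff)
  then have "\<exists>m\<in>carrier T. m \<otimes>\<^bsub>T\<^esub> \<delta> = ebar i \<ominus>\<^bsub>T\<^esub> tens (e i) \<one>\<^bsub>A\<^esub>"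
    using assms by (intro delta_dvd) auto
  then have "\<exists>m. m \<in> carrier T \<and> m \<otimes>\<^bsub>T\<^esub> \<delta> = ebar i \<ominus>\<^bsub>T\<^esub> tens (e i) \<one>\<^bsub>A\<^esub>"
    by blast
  from someI_ex[OF this] show "diag_quot i \<in> carrier T" "diag_quot i \<otimes>\<^bsub>T\<^esub> \<delta> = ebar i \<ominus>\<^bsub>T\<^esub> tens (e i) \<one>\<^bsub>A\<^esub>"
    unfolding diag_quot_def by auto
qed

text \<open>As the \<open>ebar i\<close> may be dependent, \<open>N (ebar i)\<close> need not be
  \<open>diag_quot i\<close>; only the identity after multiplication by \<delta> is claimed.\<close>

definition N where "N t = (\<Oplus>\<^bsub>T\<^esub>i\<in>{..<n}. ot (\<epsilon> i) t \<odot>\<^bsub>T\<^esub> diag_quot i)"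

lemma N_closed [simp]: "t \<in> carrier T \<Longrightarrow> N t \<in> carrier T"
  unfolding N_def by (intro T.finsum_closed) (auto simp: eps_dual)

lemma linear_N: "linear_on A T T N"
proof -
  have ot_add': "ot (\<epsilon> i) (s \<oplus>\<^bsub>T\<^esub> t) = ot (\<epsilon> i) s \<oplus>\<^bsub>A\<^esub> ot (\<epsilon> i) t"
    and ot_smult: "a \<in> carrier A \<Longrightarrow> ot (\<epsilon> i) (a \<odot>\<^bsub>T\<^esub> t) = a \<otimes>\<^bsub>A\<^esub> ot (\<epsilon> i) t"
    if "i < n" "s \<in> carrier T" "t \<in> carrier T" for a i s t
    using linear_ot[OF eps_dual[OF that(1)]] that by (simp_all add: linear_on_def)
  have "N (s \<oplus>\<^bsub>T\<^esub> t) = N s \<oplus>\<^bsub>T\<^esub> N t" if "s \<in> carrier T" "t \<in> carrier T" for s t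
  proof -
    have "N (s \<oplus>\<^bsub>T\<^esub> t) = (\<Oplus>\<^bsub>T\<^esub>i\<in>{..<n}. ot (\<epsilon> i) s \<odot>\<^bsub>T\<^esub> diag_quot i \<oplus>\<^bsub>T\<^esub> ot (\<epsilon> i) t \<odot>\<^bsub>T\<^esub> diag_quot i)"
      unfolding N_def using that
      by (intro T.finsum_cong') (auto simp: ot_add' eps_dual TM.smult_l_distr)
    also have "\<dots> = N s \<oplus>\<^bsub>T\<^esub> N t"
      unfolding N_def using that by (intro T.finsum_addf) (auto simp: eps_dual)
    finally show ?thesis .
  qed
  moreover have "N (a \<odot>\<^bsub>T\<^esub> t) = a \<odot>\<^bsub>T\<^esub> N t" if "a \<in> carrier A" "t \<in> carrier T" for a t
  proof -
    have "N (a \<odot>\<^bsub>T\<^esub> t) = (\<Oplus>\<^bsub>T\<^esub>i\<in>{..<n}. a \<odot>\<^bsub>T\<^esub> (ot (\<epsilon> i) t \<odot>\<^bsub>T\<^esub> diag_quot i))"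
      unfolding N_def using that
      by (intro T.finsum_cong') (auto simp: ot_smult eps_dual TM.smult_assoc1)
    also have "\<dots> = a \<odot>\<^bsub>T\<^esub> N t"
      unfolding N_def using that by (intro TM.finsum_smult_ldistr[symmetric]) (auto simp: eps_dual)
    finally show ?thesis .
  qed
  ultimately show ?thesis by (simp add: linear_on_def)
qed

sublocale N: module_map A T T N by unfold_locales (rule linear_N)

text \<open>Multiplication by \<delta> turns each \<open>diag_quot i\<close> into 1 \<otimes> e_i -
  e_i \<otimes> 1, and the two resulting sums are the expansions of t and of \<mu>(t) \<otimes>
  1.\<close>

lemma N_delta:
  assumes t: "t \<in> carrier T"
  shows "N t \<otimes>\<^bsub>T\<^esub> \<delta> = t \<ominus>\<^bsub>T\<^esub> tens (mu t) \<one>\<^bsub>A\<^esub>"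
proof -
  have "tens (mu t) \<one>\<^bsub>A\<^esub> = (\<Oplus>\<^bsub>T\<^esub>i\<in>{..<n}. ot (\<epsilon> i) t \<odot>\<^bsub>T\<^esub> tens (e i) \<one>\<^bsub>A\<^esub>)"
    using linear_expand[OF linear_on_comp[OF linear_tens_left linear_mu] module_T t, of "\<one>\<^bsub>A\<^esub>"]
    by (simp, intro T.finsum_cong') (auto simp: eps_dual t)
  moreover have "N t \<otimes>\<^bsub>T\<^esub> \<delta> = (\<Oplus>\<^bsub>T\<^esub>i\<in>{..<n}. (ot (\<epsilon> i) t \<odot>\<^bsub>T\<^esub> diag_quot i) \<otimes>\<^bsub>T\<^esub> \<delta>)"
    unfolding N_def using t by (intro T.finsum_ldistr) (auto simp: eps_dual)
  moreover have "\<dots> \<oplus>\<^bsub>T\<^esub> (\<Oplus>\<^bsub>T\<^esub>i\<in>{..<n}. ot (\<epsilon> i) t \<odot>\<^bsub>T\<^esub> tens (e i) \<one>\<^bsub>A\<^esub>)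
      = (\<Oplus>\<^bsub>T\<^esub>i\<in>{..<n}. (ot (\<epsilon> i) t \<odot>\<^bsub>T\<^esub> diag_quot i) \<otimes>\<^bsub>T\<^esub> \<delta> \<oplus>\<^bsub>T\<^esub> ot (\<epsilon> i) t \<odot>\<^bsub>T\<^esub> tens (e i) \<one>\<^bsub>A\<^esub>)"
    using t by (intro T.finsum_addf[symmetric]) (auto simp: eps_dual)
  moreover have "\<dots> = (\<Oplus>\<^bsub>T\<^esub>i\<in>{..<n}. ot (\<epsilon> i) t \<odot>\<^bsub>T\<^esub> ebar i)"
  proof (rule T.finsum_cong')
    fix i assume i: "i \<in> {..<n}"
    have "(ot (\<epsilon> i) t \<odot>\<^bsub>T\<^esub> diag_quot i) \<otimes>\<^bsub>T\<^esub> \<delta> \<oplus>\<^bsub>T\<^esub> ot (\<epsilon> i) t \<odot>\<^bsub>T\<^esub> tens (e i) \<one>\<^bsub>A\<^esub>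
        = ot (\<epsilon> i) t \<odot>\<^bsub>T\<^esub> ((ebar i \<ominus>\<^bsub>T\<^esub> tens (e i) \<one>\<^bsub>A\<^esub>) \<oplus>\<^bsub>T\<^esub> tens (e i) \<one>\<^bsub>A\<^esub>)"
      using i t by (simp add: smult_mult_T eps_dual diag_quot_delta TM.smult_r_distr)
    also have "(ebar i \<ominus>\<^bsub>T\<^esub> tens (e i) \<one>\<^bsub>A\<^esub>) \<oplus>\<^bsub>T\<^esub> tens (e i) \<one>\<^bsub>A\<^esub> = ebar i"
      using i by (simp add: a_minus_def T.a_assoc T.l_neg)
    finally show "(ot (\<epsilon> i) t \<odot>\<^bsub>T\<^esub> diag_quot i) \<otimes>\<^bsub>T\<^esub> \<delta> \<oplus>\<^bsub>T\<^esub> ot (\<epsilon> i) t \<odot>\<^bsub>T\<^esub> tens (e i) \<one>\<^bsub>A\<^esub>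
        = ot (\<epsilon> i) t \<odot>\<^bsub>T\<^esub> ebar i" .
  qed (use t in \<open>auto simp: eps_dual\<close>)
  ultimately have "N t \<otimes>\<^bsub>T\<^esub> \<delta> \<oplus>\<^bsub>T\<^esub> tens (mu t) \<one>\<^bsub>A\<^esub> = t"
    using expand_T[OF t] by simp
  then show ?thesis
    using t by (simp add: a_minus_def T.add.inv_solve_right)
qed

definition \<pi> where "\<pi> t = t \<ominus>\<^bsub>T\<^esub> N (t \<otimes>\<^bsub>T\<^esub> \<delta>)"

lemma linear_pi: "linear_on A T T \<pi>"
  unfolding linear_on_def \<pi>_def
  by (auto simp: a_minus_def T.l_distr N.add T.minus_add T.a_ac smult_mult_T N.smult
      TM.smult_r_distr TM.smult_r_minus)

lemma pi_closed [simp]: "t \<in> carrier T \<Longrightarrow> \<pi> t \<in> carrier T"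
  using linear_pi by (simp add: linear_on_def)

text \<open>\<mu> vanishes on t \<delta>, so the correction term in \<open>N_delta\<close>
  disappears and N(t \<delta>) \<delta> = t \<delta>.\<close>

lemma pi_in_J: assumes t: "t \<in> carrier T" shows "\<pi> t \<in> J"
proof -
  have "mu (t \<otimes>\<^bsub>T\<^esub> \<delta>) = \<zero>\<^bsub>A\<^esub>" using t by (simp add: mu_mult mu_delta)
  then have "N (t \<otimes>\<^bsub>T\<^esub> \<delta>) \<otimes>\<^bsub>T\<^esub> \<delta> = t \<otimes>\<^bsub>T\<^esub> \<delta>"
    using t by (simp add: N_delta tens_zero_left a_minus_def)
  then have "\<pi> t \<otimes>\<^bsub>T\<^esub> \<delta> = \<zero>\<^bsub>T\<^esub>"
    using t by (simp add: \<pi>_def a_minus_def T.l_distr T.l_minus T.r_neg)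
  then show ?thesis using t by (simp add: J_iff)
qed

lemma pi_J: "t \<in> J \<Longrightarrow> \<pi> t = t"
  by (simp add: \<pi>_def J_iff N.zero a_minus_def)

text \<open>T acts on J through \<mu>, so the T-multiples of \<Delta> are its A-multiples.\<close>

lemma J_eq: "J = {c \<odot>\<^bsub>T\<^esub> \<Delta> | c. c \<in> carrier A}"
proof (intro equalityI subsetI)
  fix t assume "t \<in> J"
  then show "t \<in> {c \<odot>\<^bsub>T\<^esub> \<Delta> | c. c \<in> carrier A}"
    unfolding diagonal_ann by (auto simp: mult_J intro!: mu_closed)
next
  fix t assume "t \<in> {c \<odot>\<^bsub>T\<^esub> \<Delta> | c. c \<in> carrier A}"
  then show "t \<in> J" unfolding diagonal_ann by (auto simp: smult_T)
qed

lemma smult_J: "c \<in> carrier A \<Longrightarrow> t \<in> J \<Longrightarrow> c \<odot>\<^bsub>T\<^esub> t \<in> J"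
  by (simp add: J_iff smult_mult_T)

section \<open>Freeness of J on \<Delta>\<close>

lemma Delta_faithful:
  assumes c: "c \<in> carrier A" and 0: "c \<odot>\<^bsub>T\<^esub> \<Delta> = \<zero>\<^bsub>T\<^esub>"
  shows "c = \<zero>\<^bsub>A\<^esub>"
proof -
  have cJ: "c \<odot>\<^bsub>T\<^esub> t = \<zero>\<^bsub>T\<^esub>" if "t \<in> J" for t
  proof -
    obtain b where "b \<in> carrier A" "t = b \<odot>\<^bsub>T\<^esub> \<Delta>" using \<open>t \<in> J\<close> J_eq by auto
    then show ?thesis using c 0
      by (metis A.m_comm Delta TM.smult_assoc1 TM.smult_r_null)
  qed
  \<comment> \<open>\<pi> takes values in J, which c kills.\<close>
  have cN: "c \<odot>\<^bsub>T\<^esub> N (t \<otimes>\<^bsub>T\<^esub> \<delta>) = c \<odot>\<^bsub>T\<^esub> t" if "t \<in> carrier T" for t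
    using cJ[OF pi_in_J[OF that]] c that
    by (simp add: \<pi>_def a_minus_def TM.smult_r_distr TM.smult_r_minus)
      (simp add: T.minus_eq_zero_iff flip: a_minus_def)
  have ot_smult: "ot (\<epsilon> i) (c \<odot>\<^bsub>T\<^esub> t) = c \<otimes>\<^bsub>A\<^esub> ot (\<epsilon> i) t" if "i < n" "t \<in> carrier T" for i t
    using linear_ot[OF eps_dual[OF that(1)]] that c by (simp add: linear_on_def)
  \<comment> \<open>The sum of the \<open>d i\<close> is the trace of the identity of T.\<close>
  define d where "d i = ot (\<epsilon> i) (ebar i)" for i
  have d: "d i \<in> carrier A" if "i < n" for i using that by (simp add: d_def eps_dual)
  have lin: "linear_on A T T (\<lambda>t. t \<otimes>\<^bsub>T\<^esub> \<delta>)"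
    by (simp add: linear_on_def T.l_distr smult_mult_T)
  have "c \<otimes>\<^bsub>A\<^esub> trace (\<lambda>t. N (t \<otimes>\<^bsub>T\<^esub> \<delta>)) = (\<Oplus>\<^bsub>A\<^esub>i\<in>{..<n}. c \<otimes>\<^bsub>A\<^esub> ot (\<epsilon> i) (N (ebar i \<otimes>\<^bsub>T\<^esub> \<delta>)))"
    unfolding trace_def using c by (intro A.finsum_rdistr) (auto simp: eps_dual)
  also have "\<dots> = (\<Oplus>\<^bsub>A\<^esub>i\<in>{..<n}. c \<otimes>\<^bsub>A\<^esub> d i)"
    using c by (intro A.finsum_cong') (auto simp: d cN d_def eps_dual simp flip: ot_smult)
  also have "\<dots> = c \<otimes>\<^bsub>A\<^esub> (\<Oplus>\<^bsub>A\<^esub>i\<in>{..<n}. d i)"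
    using c by (intro A.finsum_rdistr[symmetric]) (auto simp: d)
  finally have 1: "c \<otimes>\<^bsub>A\<^esub> trace (\<lambda>t. N (t \<otimes>\<^bsub>T\<^esub> \<delta>)) = c \<otimes>\<^bsub>A\<^esub> (\<Oplus>\<^bsub>A\<^esub>i\<in>{..<n}. d i)" .
  \<comment> \<open>The map from t to \<mu>(t) \<otimes> 1 has trace equal to the sum of the
    \<epsilon>_i(1) e_i, which is the dual basis expansion of 1.\<close>
  have tr1: "trace (\<lambda>t. N t \<otimes>\<^bsub>T\<^esub> \<delta>) \<oplus>\<^bsub>A\<^esub> \<one>\<^bsub>A\<^esub> = (\<Oplus>\<^bsub>A\<^esub>i\<in>{..<n}. d i)"
  proof -
    have "trace (\<lambda>t. N t \<otimes>\<^bsub>T\<^esub> \<delta>) \<oplus>\<^bsub>A\<^esub> (\<Oplus>\<^bsub>A\<^esub>i\<in>{..<n}. \<epsilon> i \<one>\<^bsub>A\<^esub> \<odot>\<^bsub>A\<^esub> e i)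
        = (\<Oplus>\<^bsub>A\<^esub>i\<in>{..<n}. ot (\<epsilon> i) (N (ebar i) \<otimes>\<^bsub>T\<^esub> \<delta>) \<oplus>\<^bsub>A\<^esub> \<epsilon> i \<one>\<^bsub>A\<^esub> \<odot>\<^bsub>A\<^esub> e i)"
      unfolding trace_def by (intro A.finsum_addf[symmetric]) (auto simp: eps_dual)
    also have "\<dots> = (\<Oplus>\<^bsub>A\<^esub>i\<in>{..<n}. d i)"
    proof (rule A.finsum_cong')
      fix i assume i: "i \<in> {..<n}"
      have "ot (\<epsilon> i) (N (ebar i) \<otimes>\<^bsub>T\<^esub> \<delta>) \<oplus>\<^bsub>A\<^esub> \<epsilon> i \<one>\<^bsub>A\<^esub> \<odot>\<^bsub>A\<^esub> e i
          = ot (\<epsilon> i) ((ebar i \<ominus>\<^bsub>T\<^esub> tens (e i) \<one>\<^bsub>A\<^esub>) \<oplus>\<^bsub>T\<^esub> tens (e i) \<one>\<^bsub>A\<^esub>)"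
        using i by (simp add: N_delta ot_add eps_dual ot_tens)
      also have "(ebar i \<ominus>\<^bsub>T\<^esub> tens (e i) \<one>\<^bsub>A\<^esub>) \<oplus>\<^bsub>T\<^esub> tens (e i) \<one>\<^bsub>A\<^esub> = ebar i"
        using i by (simp add: a_minus_def T.a_assoc T.l_neg)
      finally show "ot (\<epsilon> i) (N (ebar i) \<otimes>\<^bsub>T\<^esub> \<delta>) \<oplus>\<^bsub>A\<^esub> \<epsilon> i \<one>\<^bsub>A\<^esub> \<odot>\<^bsub>A\<^esub> e i = d i"
        by (simp add: d_def)
    qed (auto simp: d)
    finally show ?thesis by (simp add: dual_basis)
  qed
  have trc: "trace (\<lambda>t. N t \<otimes>\<^bsub>T\<^esub> \<delta>) \<in> carrier A"
    unfolding trace_def by (intro A.finsum_closed) (auto simp: eps_dual)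
  \<comment> \<open>Cyclicity of the trace identifies the two trace computations, and cancelling the
    common summand leaves c = 0.\<close>
  have "c \<otimes>\<^bsub>A\<^esub> trace (\<lambda>t. N t \<otimes>\<^bsub>T\<^esub> \<delta>) = c \<otimes>\<^bsub>A\<^esub> (trace (\<lambda>t. N t \<otimes>\<^bsub>T\<^esub> \<delta>) \<oplus>\<^bsub>A\<^esub> \<one>\<^bsub>A\<^esub>)"
    using 1 tr1 trace_comm[OF linear_N lin] by simp
  also have "\<dots> = c \<otimes>\<^bsub>A\<^esub> trace (\<lambda>t. N t \<otimes>\<^bsub>T\<^esub> \<delta>) \<oplus>\<^bsub>A\<^esub> c"
    using c trc by (simp add: A.r_distr)
  finally show ?thesis using c trc by (simp add: A.M.add.l_cancel_one')
qed

lemma JM_sel [simp]: "carrier JM = J" "\<zero>\<^bsub>JM\<^esub> = \<zero>\<^bsub>T\<^esub>"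
    "s \<oplus>\<^bsub>JM\<^esub> t = s \<oplus>\<^bsub>T\<^esub> t" "a \<odot>\<^bsub>JM\<^esub> t = a \<odot>\<^bsub>T\<^esub> t"
  by (simp_all add: diagonal_ann_module_def)

lemma module_JM: "module A JM"
proof (rule moduleI[OF A.M_cring])
  show "abelian_group JM"
  proof (rule abelian_groupI)
    show "\<exists>s\<in>carrier JM. s \<oplus>\<^bsub>JM\<^esub> t = \<zero>\<^bsub>JM\<^esub>" if "t \<in> carrier JM" for t
      using that by (intro bexI[of _ "\<ominus>\<^bsub>T\<^esub> t"]) (simp_all add: J_iff T.l_neg T.l_minus)
  qed (simp_all add: J_iff T.l_distr T.a_ac)
qed (simp_all add: J_iff smult_mult_T TM.smult_l_distr TM.smult_r_distr TM.smult_assoc1)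

lemma free_JM: "free_of_rank A JM 1"
  by (rule free_of_rank_1[OF module_JM, of \<Delta>]) (auto simp: Delta_faithful, auto simp: J_eq)

lemma smult_Delta_cancel:
  assumes "a \<in> carrier A" "b \<in> carrier A" "a \<odot>\<^bsub>T\<^esub> \<Delta> = b \<odot>\<^bsub>T\<^esub> \<Delta>"
  shows "a = b"
proof -
  have "(a \<ominus>\<^bsub>A\<^esub> b) \<odot>\<^bsub>T\<^esub> \<Delta> = \<zero>\<^bsub>T\<^esub>"
    using assms by (simp add: a_minus_def TM.smult_l_distr TM.smult_l_minus T.r_neg)
  then have "a \<ominus>\<^bsub>A\<^esub> b = \<zero>\<^bsub>A\<^esub>" using assms by (intro Delta_faithful) auto
  then show ?thesis using assms by (simp add: A.M.minus_eq_zero_iff)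
qed

section \<open>Evaluation of 1 \<otimes> \<phi> at \<Delta>\<close>

lemma ot_smult: "\<phi> \<in> D \<Longrightarrow> a \<in> carrier A \<Longrightarrow> t \<in> carrier T \<Longrightarrow>
    ot \<phi> (a \<odot>\<^bsub>T\<^esub> t) = a \<otimes>\<^bsub>A\<^esub> ot \<phi> t"
  using linear_ot by (simp add: linear_on_def)

definition coord where "coord t = (THE c. c \<in> carrier A \<and> t = c \<odot>\<^bsub>T\<^esub> \<Delta>)"

lemma coord_smult: "c \<in> carrier A \<Longrightarrow> coord (c \<odot>\<^bsub>T\<^esub> \<Delta>) = c"
  unfolding coord_def by (rule the_equality) (auto intro: smult_Delta_cancel)

lemma linear_coord: "linear_on A JM (regular_module A) coord"
  unfolding linear_on_def
  by (auto simp: J_eq coord_smult simp flip: TM.smult_l_distr TM.smult_assoc1)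

lemma linear_pi_J: "linear_on A T JM \<pi>"
  using linear_pi by (simp add: linear_on_def pi_in_J)

text \<open>The linear form on J with value 1 at \<Delta> is extended to T along \<pi> and then
  contracted to a form on A.\<close>

lemma dual_generator: "\<exists>\<phi>\<in>D. ot \<phi> \<Delta> = \<one>\<^bsub>A\<^esub>"
proof -
  define f where "f t = coord (\<pi> t)" for t
  have f: "linear_on A T (regular_module A) f"
    unfolding f_def by (rule linear_on_comp[OF linear_coord linear_pi_J])
  then have fc [simp]: "f t \<in> carrier A" if "t \<in> carrier T" for t
    using that by (simp add: linear_on_def)
  let ?\<phi> = "contraction (\<lambda>i. f (ebar i))"
  have "ot ?\<phi> \<Delta> = (\<Oplus>\<^bsub>A\<^esub>i\<in>{..<n}. ot (\<epsilon> i) (tens \<one>\<^bsub>A\<^esub> (f (ebar i)) \<otimes>\<^bsub>T\<^esub> \<Delta>))"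
    by (simp add: ot_contraction)
  \<comment> \<open>Because \<Delta> lies in J, the element 1 \<otimes> f(1 \<otimes> e_i) acts on
    it as the scalar f(1 \<otimes> e_i).\<close>
  also have "\<dots> = (\<Oplus>\<^bsub>A\<^esub>i\<in>{..<n}. ot (\<epsilon> i) \<Delta> \<otimes>\<^bsub>A\<^esub> f (ebar i))"
    by (intro A.finsum_cong') (auto simp: mult_J mu_tens ot_smult eps_dual A.m_comm)
  also have "\<dots> = f \<Delta>"
    using linear_expand[OF f RA.module_axioms Delta] by (simp add: finsum_regular)
  also have "\<dots> = \<one>\<^bsub>A\<^esub>"
    using coord_smult[of "\<one>\<^bsub>A\<^esub>"] by (simp add: f_def pi_J)
  finally show ?thesis by (intro bexI[of _ ?\<phi>] contraction_dual) auto
qed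

lemma dual_eq_zero:
  assumes \<phi>: "\<phi> \<in> D" and 0: "ot \<phi> \<Delta> = \<zero>\<^bsub>A\<^esub>"
  shows "\<phi> = \<zero>\<^bsub>DM\<^esub>"
proof (rule dual_eqI[OF \<phi> DM_zero_closed])
  fix y assume y: "y \<in> carrier A"
  define f where "f t = ot \<phi> (N t)" for t
  have f: "linear_on A T (regular_module A) f"
    unfolding f_def by (rule linear_on_comp[OF linear_ot[OF \<phi>] linear_N])
  then have fc [simp]: "f t \<in> carrier A" if "t \<in> carrier T" for t
    using that by (simp add: linear_on_def)
  \<comment> \<open>In t = \<pi>(t) + N(t \<delta>) the first summand is a multiple of \<Delta>,
    where 1 \<otimes> \<phi> vanishes.\<close>
  have ot_f: "ot \<phi> t = f (t \<otimes>\<^bsub>T\<^esub> \<delta>)" if t: "t \<in> carrier T" for t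
  proof -
    obtain c where "c \<in> carrier A" "\<pi> t = c \<odot>\<^bsub>T\<^esub> \<Delta>" using pi_in_J[OF t] J_eq by auto
    then have "ot \<phi> (\<pi> t) = \<zero>\<^bsub>A\<^esub>" using \<phi> 0 by (simp add: ot_smult)
    moreover have "t = \<pi> t \<oplus>\<^bsub>T\<^esub> N (t \<otimes>\<^bsub>T\<^esub> \<delta>)"
      using t by (simp add: \<pi>_def a_minus_def T.a_assoc T.l_neg)
    then have "ot \<phi> t = ot \<phi> (\<pi> t) \<oplus>\<^bsub>A\<^esub> f (t \<otimes>\<^bsub>T\<^esub> \<delta>)"
      unfolding f_def using \<phi> t by (metis ot_add pi_closed N_closed T.m_closed delta)
    ultimately show ?thesis using t by simp
  qed
  have "\<phi> (e i) \<odot>\<^bsub>A\<^esub> \<one>\<^bsub>A\<^esub> = f (\<delta> \<otimes>\<^bsub>T\<^esub> ebar i)" if "i < n" for i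
    using that \<phi> ot_f[of "ebar i"] by (simp add: ebar_def ot_tens T.m_comm)
  \<comment> \<open>The left side contracts back to \<phi>(y); on the right,
    \<open>contraction_mult\<close> extracts the factor \<mu>(\<delta>) = 0.\<close>
  then have "contraction (\<lambda>i. \<phi> (e i) \<odot>\<^bsub>A\<^esub> \<one>\<^bsub>A\<^esub>) y = contraction (\<lambda>i. f (\<delta> \<otimes>\<^bsub>T\<^esub> ebar i)) y"
    using y by (auto simp: contraction_def intro!: A.R.finsum_cong')
  then have "\<phi> y = contraction (\<lambda>i. f (ebar i)) (mu \<delta> \<otimes>\<^bsub>A\<^esub> y)"
    using \<phi> y by (simp add: contraction_const contraction_mult[OF f])
  also have "\<dots> = \<zero>\<^bsub>k\<^esub>"
    using y dual_smult[OF contraction_dual, of "\<lambda>i. f (ebar i)" "\<zero>\<^bsub>k\<^esub>" "\<zero>\<^bsub>A\<^esub>"]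
      dual_closed[OF contraction_dual, of "\<lambda>i. f (ebar i)" "\<zero>\<^bsub>A\<^esub>"]
    by (simp add: mu_delta)
  finally show "\<phi> y = \<zero>\<^bsub>DM\<^esub> y" using y by (simp add: DM_zero)
qed

text \<open>Homogeneity rests on \<Delta> being in J: a acts on \<phi> through 1 \<otimes> a, which
  on \<Delta> equals a \<otimes> 1.\<close>

lemma linear_at_Delta: "linear_on A DM (regular_module A) (\<lambda>\<phi>. ot \<phi> \<Delta>)"
  by (simp add: linear_on_def ot_DM_add ot_DM_smult mult_J mu_tens ot_smult)

lemma dual_eq_iff:
  assumes "\<phi> \<in> D" "\<psi> \<in> D" "ot \<phi> \<Delta> = ot \<psi> \<Delta>"
  shows "\<phi> = \<psi>"
proof -
  have \<chi>: "\<phi> \<ominus>\<^bsub>DM\<^esub> \<psi> \<in> D" using assms DM.M.minus_closed by simp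
  have "\<phi> = (\<phi> \<ominus>\<^bsub>DM\<^esub> \<psi>) \<oplus>\<^bsub>DM\<^esub> \<psi>"
    using assms(1,2) DM.M.a_inv_closed by (simp add: a_minus_def DM.M.a_assoc DM.M.l_neg)
  then have "ot \<phi> \<Delta> = ot (\<phi> \<ominus>\<^bsub>DM\<^esub> \<psi>) \<Delta> \<oplus>\<^bsub>A\<^esub> ot \<psi> \<Delta>"
    using ot_DM_add[OF \<chi> assms(2) Delta] by simp
  then have "ot (\<phi> \<ominus>\<^bsub>DM\<^esub> \<psi>) \<Delta> = \<zero>\<^bsub>A\<^esub>"
    using assms \<chi> by (simp add: A.M.add.l_cancel_one')
  from dual_eq_zero[OF \<chi> this] show ?thesis
    using assms by (simp add: DM.M.minus_eq_zero_iff)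
qed

text \<open>Both sides have the same value at \<Delta>, and evaluation there is injective by
  \<open>dual_eq_iff\<close>.\<close>

lemma dual_generated:
  assumes "\<phi>\<^sub>0 \<in> D" "ot \<phi>\<^sub>0 \<Delta> = \<one>\<^bsub>A\<^esub>" "\<phi> \<in> D"
  shows "\<phi> = ot \<phi> \<Delta> \<odot>\<^bsub>DM\<^esub> \<phi>\<^sub>0"
  by (rule dual_eq_iff) (use assms linear_at_Delta in \<open>simp_all add: linear_on_def\<close>)

lemma free_DM: "free_of_rank A DM 1"
proof -
  obtain \<phi>\<^sub>0 where \<phi>\<^sub>0: "\<phi>\<^sub>0 \<in> D" "ot \<phi>\<^sub>0 \<Delta> = \<one>\<^bsub>A\<^esub>" using dual_generator by blast
  interpret h: module_map A DM "regular_module A" "\<lambda>\<phi>. ot \<phi> \<Delta>"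
    by unfold_locales (rule linear_at_Delta)
  show ?thesis
  proof (rule free_of_rank_1[OF module_DM])
    show "\<phi>\<^sub>0 \<in> carrier DM" using \<phi>\<^sub>0 by simp
    show "a = \<zero>\<^bsub>A\<^esub>" if "a \<in> carrier A" "a \<odot>\<^bsub>DM\<^esub> \<phi>\<^sub>0 = \<zero>\<^bsub>DM\<^esub>" for a
      using h.smult[of a \<phi>\<^sub>0] h.zero that \<phi>\<^sub>0 by simp
    show "\<exists>a\<in>carrier A. \<phi> = a \<odot>\<^bsub>DM\<^esub> \<phi>\<^sub>0" if "\<phi> \<in> carrier DM" for \<phi>
      using dual_generated[OF \<phi>\<^sub>0] that by (intro bexI[of _ "ot \<phi> \<Delta>"]) simp_all
  qed
qed

text \<open>A linear form on J = A \<Delta> is determined by its value at \<Delta>, so bijectivity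
  reduces to that of evaluation at \<Delta>.\<close>

lemma theta0_iso:
  "theta0 k A \<in> module_iso A DM (Hom_module A JM (regular_module A))"
proof -
  let ?H = "Hom_module A JM (regular_module A)"
  have J: "t \<in> carrier T" if "t \<in> J" for t using that by (simp add: J_iff)
  have H: "carrier ?H = linear_maps A JM (regular_module A)"
    "f \<oplus>\<^bsub>?H\<^esub> g = (\<lambda>t\<in>J. f t \<oplus>\<^bsub>A\<^esub> g t)" "a \<odot>\<^bsub>?H\<^esub> f = (\<lambda>t\<in>J. a \<otimes>\<^bsub>A\<^esub> f t)" for f g a
    by (simp_all add: Hom_module_def)
  have theta: "theta0 k A \<phi> = restrict (ot \<phi>) J" if "\<phi> \<in> D" for \<phi>
    using that by (simp add: theta0_def)
  have J_add: "s \<oplus>\<^bsub>T\<^esub> t \<in> J" if "s \<in> J" "t \<in> J" for s t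
    using that by (simp add: J_iff T.l_distr)
  have closed: "theta0 k A \<phi> \<in> linear_maps A JM (regular_module A)" if "\<phi> \<in> D" for \<phi>
    unfolding linear_maps_iff linear_on_def using that
    by (auto simp: theta J J_add smult_J ot_add ot_smult)
  have "theta0 k A \<in> linear_maps A DM ?H"
    unfolding linear_maps_iff linear_on_def
  proof (intro conjI ballI)
    show "theta0 k A \<in> extensional (carrier DM)" by (simp add: theta0_def)
    show "theta0 k A (\<phi> \<oplus>\<^bsub>DM\<^esub> \<psi>) = theta0 k A \<phi> \<oplus>\<^bsub>?H\<^esub> theta0 k A \<psi>"
      if "\<phi> \<in> carrier DM" "\<psi> \<in> carrier DM" for \<phi> \<psi>
      using that by (auto simp: theta H ot_DM_add J intro!: restrict_ext)
    show "theta0 k A (a \<odot>\<^bsub>DM\<^esub> \<phi>) = a \<odot>\<^bsub>?H\<^esub> theta0 k A \<phi>"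
      if "a \<in> carrier A" "\<phi> \<in> carrier DM" for a \<phi>
      using that by (auto simp: theta H ot_DM_smult J mult_J mu_tens ot_smult intro!: restrict_ext)
  qed (simp add: H closed)
  moreover have "bij_betw (theta0 k A) (carrier DM) (carrier ?H)"
  proof (rule bij_betwI')
    fix \<phi> \<psi> assume "\<phi> \<in> carrier DM" "\<psi> \<in> carrier DM"
    then show "theta0 k A \<phi> = theta0 k A \<psi> \<longleftrightarrow> \<phi> = \<psi>"
      using dual_eq_iff[of \<phi> \<psi>] Delta_in_J by (metis carrier_DM restrict_apply' theta)
  next
    show "theta0 k A \<phi> \<in> carrier ?H" if "\<phi> \<in> carrier DM" for \<phi>
      using that by (simp add: H closed)
  next
    fix f assume "f \<in> carrier ?H"
    then have f: "f \<in> extensional J" "linear_on A JM (regular_module A) f"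
      by (simp_all add: H linear_maps_iff)
    obtain \<phi>\<^sub>0 where \<phi>\<^sub>0: "\<phi>\<^sub>0 \<in> D" "ot \<phi>\<^sub>0 \<Delta> = \<one>\<^bsub>A\<^esub>" using dual_generator by blast
    have fD: "f \<Delta> \<in> carrier A" using f(2) by (simp add: linear_on_def)
    \<comment> \<open>This multiple of \<open>\<phi>\<^sub>0\<close> takes the value f(\<Delta>) at
      \<Delta>; linearity over A then gives agreement with f on all of J.\<close>
    let ?\<phi> = "f \<Delta> \<odot>\<^bsub>DM\<^esub> \<phi>\<^sub>0"
    have \<phi>: "?\<phi> \<in> D" "ot ?\<phi> \<Delta> = f \<Delta>"
      using \<phi>\<^sub>0 fD linear_at_Delta by (simp_all add: linear_on_def)
    have "f = theta0 k A ?\<phi>"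
    proof (rule extensionalityI[OF f(1)])
      show "theta0 k A ?\<phi> \<in> extensional J" using \<phi> by (simp add: theta)
      fix t assume t: "t \<in> J"
      then obtain c where c: "c \<in> carrier A" "t = c \<odot>\<^bsub>T\<^esub> \<Delta>" using J_eq by auto
      then have "f t = c \<otimes>\<^bsub>A\<^esub> f \<Delta>" using f(2) by (simp add: linear_on_def)
      then show "f t = theta0 k A ?\<phi> t" using t c \<phi> by (simp add: theta ot_smult)
    qed
    then show "\<exists>\<phi>\<in>carrier DM. f = theta0 k A \<phi>" using \<phi> by auto
  qed
  ultimately show ?thesis by (simp add: module_iso_def)
qed

end

section \<open>A dual basis from a retraction of a free module\<close>

lemma fg_projective_dual_basis:
  assumes "algebra k A" "fg_projective k A"
  obtains n e \<epsilon> where "dual_basis_algebra k A n e \<epsilon>"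
proof -
  interpret algebra k A by fact
  obtain n s p where s: "s \<in> linear_maps k A (free_module k n)"
    and p: "p \<in> linear_maps k (free_module k n) A" and ps: "\<And>x. x \<in> carrier A \<Longrightarrow> p (s x) = x"
    using assms(2) by (auto simp: fg_projective_def)
  let ?F = "free_module k n"
  have carr: "carrier ?F = {..<n} \<rightarrow>\<^sub>E carrier k" by (simp add: free_module_def)
  have F_add: "v \<oplus>\<^bsub>?F\<^esub> w = (\<lambda>i\<in>{..<n}. v i \<oplus>\<^bsub>k\<^esub> w i)"
    and F_smult: "a \<odot>\<^bsub>?F\<^esub> v = (\<lambda>i\<in>{..<n}. a \<otimes>\<^bsub>k\<^esub> v i)" for v w a
    by (simp_all add: free_module_def)
  have p_closed: "p v \<in> carrier A" if "v \<in> carrier ?F" for v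
    using p that by (simp add: linear_maps_iff linear_on_def)
  have p_add: "p (v \<oplus>\<^bsub>?F\<^esub> w) = p v \<oplus>\<^bsub>A\<^esub> p w" if "v \<in> carrier ?F" "w \<in> carrier ?F" for v w
    using p that by (simp add: linear_maps_iff linear_on_def)
  have p_smult: "p (a \<odot>\<^bsub>?F\<^esub> v) = a \<odot>\<^bsub>A\<^esub> p v" if "a \<in> carrier k" "v \<in> carrier ?F" for a v
    using p that by (simp add: linear_maps_iff linear_on_def)
  define unit where "unit i = (\<lambda>j\<in>{..<n}. if j = i then \<one>\<^bsub>k\<^esub> else \<zero>\<^bsub>k\<^esub>)" for i
  have unit: "unit i \<in> carrier ?F" for i by (auto simp: carr unit_def)
  have p_sum: "p v = (\<Oplus>\<^bsub>A\<^esub>i\<in>{..<n}. v i \<odot>\<^bsub>A\<^esub> p (unit i))" if v: "v \<in> carrier ?F" for v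
  proof -
    have vi: "v i \<in> carrier k" if "i < n" for i using v that by (auto simp: carr)
    \<comment> \<open>\<open>cut m\<close> keeps the first m coordinates of v, so that the sum is
      built up one coordinate at a time from additivity and homogeneity of \<open>p\<close>.\<close>
    define cut where "cut m = (\<lambda>j\<in>{..<n}. if j < m then v j else \<zero>\<^bsub>k\<^esub>)" for m
    have cut: "cut m \<in> carrier ?F" for m using vi by (auto simp: carr cut_def)
    have "m \<le> n \<Longrightarrow> p (cut m) = (\<Oplus>\<^bsub>A\<^esub>i\<in>{..<m}. v i \<odot>\<^bsub>A\<^esub> p (unit i))" for m
    proof (induction m)
      case 0
      \<comment> \<open>Writing the zero vector as a zero multiple lets homogeneity of
        \<open>p\<close> show that it maps to zero.\<close>
      have "cut 0 = \<zero>\<^bsub>k\<^esub> \<odot>\<^bsub>?F\<^esub> cut 0" by (auto simp: cut_def F_smult)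
      then have "p (cut 0) = p (\<zero>\<^bsub>k\<^esub> \<odot>\<^bsub>?F\<^esub> cut 0)" by (rule arg_cong)
      also have "\<dots> = \<zero>\<^bsub>A\<^esub>" using p_smult[OF _ cut] p_closed[OF cut] by simp
      finally show ?case by simp
    next
      case (Suc m)
      have vm: "v m \<odot>\<^bsub>?F\<^esub> unit m \<in> carrier ?F"
        using vi Suc.prems by (auto simp: carr F_smult unit_def)
      have "cut (Suc m) = cut m \<oplus>\<^bsub>?F\<^esub> v m \<odot>\<^bsub>?F\<^esub> unit m"
        using vi Suc.prems by (auto simp: cut_def F_add F_smult unit_def fun_eq_iff less_Suc_eq)
      then have "p (cut (Suc m)) = p (cut m) \<oplus>\<^bsub>A\<^esub> v m \<odot>\<^bsub>A\<^esub> p (unit m)"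
        using p_add[OF cut vm, of m] p_smult[OF _ unit, of "v m" m] vi Suc.prems by simp
      then show ?case
        using Suc vi p_closed[OF unit] by (simp add: lessThan_Suc M.a_comm Pi_def)
    qed
    then have "p (cut n) = (\<Oplus>\<^bsub>A\<^esub>i\<in>{..<n}. v i \<odot>\<^bsub>A\<^esub> p (unit i))" by blast
    moreover have "cut n = v"
      by (rule extensionalityI[of _ "{..<n}"]) (use v in \<open>auto simp: carr cut_def PiE_def\<close>)
    ultimately show ?thesis by simp
  qed
  have s_closed: "s x \<in> carrier ?F" if "x \<in> carrier A" for x
    using s that by (simp add: linear_maps_iff linear_on_def)
  \<comment> \<open>The dual basis consists of the images under \<open>p\<close> of the unit vectors
    and the coordinate functions of \<open>s\<close>; its defining identity is p(s(x)) = x.\<close>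
  define \<epsilon> where "\<epsilon> i = (\<lambda>x\<in>carrier A. s x i)" for i
  have "dual_basis_algebra k A n (\<lambda>i. p (unit i)) \<epsilon>"
  proof (intro dual_basis_algebra.intro algebra_pair.intro dual_basis_algebra_axioms.intro assms(1))
    show "p (unit i) \<in> carrier A" for i by (rule p_closed[OF unit])
    show "\<epsilon> i \<in> linear_maps k A (regular_module k)" if "i < n" for i
      unfolding linear_maps_iff linear_on_def using s that s_closed
      by (auto simp: \<epsilon>_def linear_maps_iff linear_on_def F_add F_smult carr)
    show "(\<Oplus>\<^bsub>A\<^esub>i\<in>{..<n}. \<epsilon> i x \<odot>\<^bsub>A\<^esub> p (unit i)) = x" if "x \<in> carrier A" for x
      using that p_sum[OF s_closed[OF that]] ps[OF that] by (simp add: \<epsilon>_def)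
  qed
  then show thesis by (rule that)
qed

lemma (in cring) principalidealE:
  assumes "principalideal I R"
  obtains g where "g \<in> carrier R" "I = {x \<otimes> g | x. x \<in> carrier R}"
  using principalideal.generate[OF assms] cgenideal_eq_genideal cgenideal_def by metis

theorem theorem21p1:
  fixes k :: "('k, 'c) ring_scheme" and A :: "('k, 'a, 'd) module_scheme" and r :: nat
  assumes "algebra k A"
    and "fg_projective k A"
    and "has_rank k A r"
    and "principalideal (diagonal_ideal k A) (tensor_product k A A)"
    and "principalideal (diagonal_ann k A) (tensor_product k A A)"
  shows "free_of_rank A (dual_module k A) 1
    \<and> free_of_rank A (diagonal_ann_module k A) 1
    \<and> theta0 k A \<in> module_iso A (dual_module k A)
         (Hom_module A (diagonal_ann_module k A) (regular_module A))"
proof -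
  obtain n e \<epsilon> where "dual_basis_algebra k A n e \<epsilon>"
    using fg_projective_dual_basis[OF assms(1,2)] .
  then interpret dual_basis_algebra k A n e \<epsilon> .
  obtain \<delta> where \<delta>: "\<delta> \<in> carrier T" "diagonal_ideal k A = {t \<otimes>\<^bsub>T\<^esub> \<delta> | t. t \<in> carrier T}"
    using T.principalidealE[OF assms(4)] .
  obtain \<Delta> where \<Delta>: "\<Delta> \<in> carrier T" "J = {t \<otimes>\<^bsub>T\<^esub> \<Delta> | t. t \<in> carrier T}"
    using T.principalidealE[OF assms(5)] .
  interpret principal_diagonal k A n e \<epsilon> \<delta> \<Delta>
    by unfold_locales (fact \<delta> \<Delta>)+
  show ?thesis using free_DM free_JM theta0_iso by simp
qed

end
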